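(* Let $\mathfrak g$ be a finite-dimensional Lie algebra over $K$ and let $\theta$ be a nontrivial action of $\mathfrak g$ on $K[t]$. Then there is a one-to-one correspondence between Lie Rinehart bialgebras $(K(t)\otimes\mathfrak g,d_* )$ on the crossed product $K(t)\otimes\mathfrak g$ and equivalence classes of compatible pairs $(\Lambda,\Omega)$, given by $$d_*=[\Lambda,\cdot]+\Omega .$$
   Context: $K=\mathbb R$ or $\mathbb C$; $K(t)$ is the fraction field of $K[t]$. $\operatorname{Der}K[t]$ is identified with $K[t]$ via $f\leftrightarrow f\frac d{dt}$ (bracket $[f,g]=fg'-f'g$), similarly $\operatorname{Der}K(t)\cong K(t)$. An action of $\mathfrak g$ on $K[t]$ is a Lie algebra morphism $\theta:\mathfrak g\to\operatorname{Der}K[t]$; nontrivial means $\theta\ne0$. A Lie Rinehart algebra over a commutative unital $K$-algebra $A$ is an $A$-module $E$ that is a $K$-Lie algebra with an anchor $\theta:E\to\operatorname{Der}A$, a morphism of Lie algebras and $A$-modules, with $[x,ay]=a[x,y]+\theta(x)(a)y$. The crossed product $K(t)\otimes\mathfrak g$ is the Lie Rinehart algebra over $A=K(t)$ with anchor the $K(t)$-linear extension of $\theta$ and bracket $[aX,bY]=ab[X,Y]+a(\theta(X)b)Y-b(\theta(Y)a)X$. The Schouten bracket on $\wedge_A^\bullet E$ (with $\wedge^0_AE=A$, $[\wedge^k,\wedge^l]\subset\wedge^{k+l-1}$) is the $K$-bilinear graded Lie bracket ($[x,y]=-(-1)^{(|x|-1)(|y|-1)}[y,x]$) extending the bracket of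 $E$, with $[x,f]=\theta(x)f$ for $x\in E,f\in A$, and $[x,y\wedge z]=[x,y]\wedge z+(-1)^{(|x|-1)|y|}y\wedge[x,z]$. For $E=K(t)\otimes\mathfrak g$, $\wedge^k_{K(t)}E=K(t)\otimes\wedge^k\mathfrak g$. A Lie Rinehart bialgebra $(E,\sigma)$ is a Lie Rinehart algebra $E$ with a $K$-linear operator $\sigma:\wedge^k_AE\to\wedge^{k+1}_AE$ ($k\ge0$) such that $\sigma(x\wedge y)=\sigma x\wedge y+(-1)^{|x|}x\wedge\sigma y$, $\sigma^2=0$, and $\sigma[x,y]=[\sigma x,y]+(-1)^{|x|+1}[x,\sigma y]$ for all $x\in\wedge_A^{|x|}E$, $y\in\wedge_A^\bullet E$. Let $L$ be the kernel of $\theta:K(t)\otimes\mathfrak g\to K(t)$ and $L^2=L\wedge_{K(t)}L$. A $K$-linear map $\Omega:\mathfrak g\to L^2$ is a $1$-cocycle if $\Omega[X,Y]=[\Omega(X),Y]+[X,\Omega(Y)]$ for all $X,Y\in\mathfrak g$. It is extended to $\Omega:K(t)\otimes\wedge^k\mathfrak g\to K(t)\otimes\wedge^{k+1}\mathfrak g$ by $\Omega=0$ for $k=0$, $\Omega(fX)=f\Omega(X)$ for $k=1$, and $\Omega(u_1\wedge\cdots\wedge u_k)=\sum_i(-1)^{i+1}u_1\wedge\cdots\wedge\Omega(u_i)\wedge\cdots\wedge u_k$. A pair $(\Lambda,\Omega)$, with $\Lambda\in K(t)\otimes\wedge^2\mathfrak g$ and $\Omega:\mathfrak g\to L^2$ $K$-linear,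 is compatible if $\Omega$ is a $1$-cocycle and $[\frac12[\Lambda,\Lambda]+\Omega(\Lambda),\cdot]+\Omega^2=0$ as a map $K(t)\otimes\mathfrak g\to K(t)\otimes\wedge^3\mathfrak g$. Compatible pairs $(\Lambda,\Omega)$ and $(\Lambda',\Omega')$ are equivalent if there is $\nu\in L^2$ with $\Lambda'=\Lambda+\nu$ and $\Omega'=\Omega-[\nu,\cdot]$. *)

theory Defs
  imports "HOL-Analysis.Analysis" "HOL-Computational_Algebra.Computational_Algebra"
begin

section \<open>Lie algebras and Lie Rinehart algebras\<close>

locale lie_algebra = vector_space smul
  for smul :: "'k::field \<Rightarrow> 'g::ab_group_add \<Rightarrow> 'g" +
  fixes bracket :: "'g \<Rightarrow> 'g \<Rightarrow> 'g"
  assumes bracket_linear_left: "Vector_Spaces.linear smul smul (\<lambda>x. bracket x y)"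
    and bracket_linear_right: "Vector_Spaces.linear smul smul (\<lambda>y. bracket x y)"
    and bracket_self: "bracket x x = 0"
    and jacobi: "bracket x (bracket y z) + bracket y (bracket z x) + bracket z (bracket x y) = 0"

text \<open>A commutative unital \<open>K\<close>-algebra \<open>A\<close> is given by its structure map \<open>emb\<close>, a unital ring
  homomorphism from \<open>K\<close> to \<open>A\<close>.\<close>

definition algebra_map :: "('k::field \<Rightarrow> 'a::comm_ring_1) \<Rightarrow> bool" where
  "algebra_map emb \<longleftrightarrow> emb 1 = 1 \<and> (\<forall>c d. emb (c + d) = emb c + emb d) \<and>
     (\<forall>c d. emb (c * d) = emb c * emb d)"

definition derivation :: "('k::field \<Rightarrow> 'a::comm_ring_1) \<Rightarrow> ('a \<Rightarrow> 'a) \<Rightarrow> bool" where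
  "derivation emb D \<longleftrightarrow>
     Vector_Spaces.linear (\<lambda>c f. emb c * f) (\<lambda>c f. emb c * f) D \<and>
     (\<forall>f g. D (f * g) = D f * g + f * D g)"

locale lie_rinehart_algebra =
  fixes emb :: "'k::field \<Rightarrow> 'a::comm_ring_1"
    and smul :: "'a \<Rightarrow> 'e::ab_group_add \<Rightarrow> 'e"
    and bracket :: "'e \<Rightarrow> 'e \<Rightarrow> 'e"
    and anchor :: "'e \<Rightarrow> 'a \<Rightarrow> 'a"
  assumes algebra: "algebra_map emb"
    and module: "module smul"
    and lie_algebra: "lie_algebra (\<lambda>c. smul (emb c)) bracket"
    and anchor_derivation: "derivation emb (anchor x)"
    and anchor_add: "anchor (x + y) f = anchor x f + anchor y f"
    and anchor_scale: "anchor (smul a x) f = a * anchor x f"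
    and anchor_bracket: "anchor (bracket x y) f = anchor x (anchor y f) - anchor y (anchor x f)"
    and leibniz: "bracket x (smul a y) = smul a (bracket x y) + smul (anchor x a) y"


section \<open>The exterior algebra of a free module\<close>

text \<open>For \<open>E = A\<^sup>n\<close> with basis \<open>(e\<^sub>i)\<close> indexed by a finite linearly ordered type, the exterior
  algebra is the free \<open>A\<close>-module on the monomials \<open>e\<^sub>I\<close>, where \<open>I\<close> ranges over the sets of indices
  and \<open>e\<^sub>I\<close> is the wedge product of the \<open>e\<^sub>i\<close>, \<open>i \<in> I\<close>, in increasing order.\<close>

type_synonym ('a, 'n) ext = "('a, 'n set) vec"

definition ext_power :: "nat \<Rightarrow> ('a::comm_ring_1, 'n::finite) ext set" where
  "ext_power k = {w. \<forall>I. w $ I \<noteq> 0 \<longrightarrow> card I = k}"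

definition monomial :: "'n set \<Rightarrow> ('a::comm_ring_1, 'n::finite) ext" where
  "monomial I = axis I 1"

text \<open>\<open>e\<^sub>I \<and> e\<^sub>J = shuffle_sign I J \<cdot> e\<^bsub>I \<union> J\<^esub>\<close> for disjoint \<open>I\<close> and \<open>J\<close>.\<close>

definition shuffle_sign :: "'n::linorder set \<Rightarrow> 'n set \<Rightarrow> 'a::comm_ring_1" where
  "shuffle_sign I J = (-1) ^ card {(i, j). i \<in> I \<and> j \<in> J \<and> j < i}"

definition wedge ::
  "('a::comm_ring_1, 'n::{finite,linorder}) ext \<Rightarrow> ('a, 'n) ext \<Rightarrow> ('a, 'n) ext"
  (infixl \<open>\<^bold>\<and>\<close> 72) where
  "u \<^bold>\<and> v = (\<chi> K. \<Sum>I\<in>Pow K. shuffle_sign I (K - I) * u $ I * v $ (K - I))"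

definition ext_scalar :: "'a::comm_ring_1 \<Rightarrow> ('a, 'n::finite) ext" where
  "ext_scalar f = f *s monomial {}"

definition ext_vector :: "'a::comm_ring_1 ^ 'n::finite \<Rightarrow> ('a, 'n) ext" where
  "ext_vector x = (\<Sum>i\<in>UNIV. x $ i *s monomial {i})"

definition ext_linear ::
  "('k::field \<Rightarrow> 'a::comm_ring_1) \<Rightarrow> (('a, 'n::finite) ext \<Rightarrow> ('a, 'n) ext) \<Rightarrow> bool" where
  "ext_linear emb \<sigma> \<longleftrightarrow> Vector_Spaces.linear (\<lambda>c w. emb c *s w) (\<lambda>c w. emb c *s w) \<sigma>"


section \<open>The Schouten bracket and Lie Rinehart bialgebras\<close>

text \<open>Since degrees are natural numbers, \<open>(-1)\<^bsup>k + 1\<^esup>\<close> replaces \<open>(-1)\<^bsup>k - 1\<^esup>\<close>. The degree condition is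
  written so that the bracket of two elements of degree \<open>0\<close> vanishes.\<close>

definition is_schouten ::
  "('k::field \<Rightarrow> 'a::comm_ring_1) \<Rightarrow>
   (('a, 'n) vec \<Rightarrow> ('a, 'n) vec \<Rightarrow> ('a, 'n) vec) \<Rightarrow> (('a, 'n) vec \<Rightarrow> 'a \<Rightarrow> 'a) \<Rightarrow>
   (('a, 'n::{finite,linorder}) ext \<Rightarrow> ('a, 'n) ext \<Rightarrow> ('a, 'n) ext) \<Rightarrow> bool" where
  "is_schouten emb bracket anchor S \<longleftrightarrow>
     (\<forall>x. ext_linear emb (\<lambda>y. S x y)) \<and> (\<forall>y. ext_linear emb (\<lambda>x. S x y)) \<and>
     (\<forall>k l. \<forall>x\<in>ext_power k. \<forall>y\<in>ext_power l. \<forall>I. S x y $ I \<noteq> 0 \<longrightarrow> card I + 1 = k + l) \<and>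
     (\<forall>k l. \<forall>x\<in>ext_power k. \<forall>y\<in>ext_power l.
        S x y = - ((-1) ^ ((k + 1) * (l + 1)) *s S y x)) \<and>
     (\<forall>k l. \<forall>x\<in>ext_power k. \<forall>y\<in>ext_power l. \<forall>z.
        S x (S y z) = S (S x y) z + (-1) ^ ((k + 1) * (l + 1)) *s S y (S x z)) \<and>
     (\<forall>x y. S (ext_vector x) (ext_vector y) = ext_vector (bracket x y)) \<and>
     (\<forall>x f. S (ext_vector x) (ext_scalar f) = ext_scalar (anchor x f)) \<and>
     (\<forall>k l. \<forall>x\<in>ext_power k. \<forall>y\<in>ext_power l. \<forall>z.
        S x (y \<^bold>\<and> z) = S x y \<^bold>\<and> z + (-1) ^ ((k + 1) * l) *s (y \<^bold>\<and> S x z))"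

definition schouten ::
  "('k::field \<Rightarrow> 'a::comm_ring_1) \<Rightarrow>
   (('a, 'n) vec \<Rightarrow> ('a, 'n) vec \<Rightarrow> ('a, 'n) vec) \<Rightarrow> (('a, 'n) vec \<Rightarrow> 'a \<Rightarrow> 'a) \<Rightarrow>
   ('a, 'n::{finite,linorder}) ext \<Rightarrow> ('a, 'n) ext \<Rightarrow> ('a, 'n) ext" where
  "schouten emb bracket anchor = (THE S. is_schouten emb bracket anchor S)"

definition lie_rinehart_bialgebra ::
  "('k::field \<Rightarrow> 'a::comm_ring_1) \<Rightarrow>
   (('a, 'n) vec \<Rightarrow> ('a, 'n) vec \<Rightarrow> ('a, 'n) vec) \<Rightarrow> (('a, 'n) vec \<Rightarrow> 'a \<Rightarrow> 'a) \<Rightarrow>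
   (('a, 'n::{finite,linorder}) ext \<Rightarrow> ('a, 'n) ext) \<Rightarrow> bool" where
  "lie_rinehart_bialgebra emb bracket anchor \<sigma> \<longleftrightarrow>
     lie_rinehart_algebra emb (*s) bracket anchor \<and>
     ext_linear emb \<sigma> \<and>
     (\<forall>k. \<forall>x\<in>ext_power k. \<sigma> x \<in> ext_power (k + 1)) \<and>
     (\<forall>k. \<forall>x\<in>ext_power k. \<forall>y. \<sigma> (x \<^bold>\<and> y) = \<sigma> x \<^bold>\<and> y + (-1) ^ k *s (x \<^bold>\<and> \<sigma> y)) \<and>
     (\<forall>x. \<sigma> (\<sigma> x) = 0) \<and>
     (\<forall>k. \<forall>x\<in>ext_power k. \<forall>y.
        \<sigma> (schouten emb bracket anchor x y) =
          schouten emb bracket anchor (\<sigma> x) y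
          + (-1) ^ (k + 1) *s schouten emb bracket anchor x (\<sigma> y))"


section \<open>Actions on \<open>K[t]\<close> and the crossed product\<close>

definition to_rat :: "'k::field poly \<Rightarrow> 'k poly fract" where
  "to_rat p = Fract p 1"

definition const_rat :: "'k::field \<Rightarrow> 'k poly fract" where
  "const_rat c = to_rat [:c:]"

definition rat_deriv :: "'k::field poly fract \<Rightarrow> 'k poly fract" where
  "rat_deriv f = (THE g. \<exists>p q. q \<noteq> 0 \<and> f = Fract p q \<and>
     g = Fract (pderiv p * q - p * pderiv q) (q * q))"

lemma rat_deriv_Fract:
  fixes p q :: "'k::field poly"
  assumes "q \<noteq> 0"
  shows "rat_deriv (Fract p q) = Fract (pderiv p * q - p * pderiv q) (q * q)"
  unfolding rat_deriv_def
proof (rule the_equality)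
  show "\<exists>p' q'. q' \<noteq> 0 \<and> Fract p q = Fract p' q' \<and>
      Fract (pderiv p * q - p * pderiv q) (q * q)
        = Fract (pderiv p' * q' - p' * pderiv q') (q' * q')"
    using assms by blast
next
  fix g
  assume "\<exists>r s. s \<noteq> 0 \<and> Fract p q = Fract r s \<and>
    g = Fract (pderiv r * s - r * pderiv s) (s * s)"
  then obtain r s where nz: "s \<noteq> 0" and "Fract p q = Fract r s"
    and g: "g = Fract (pderiv r * s - r * pderiv s) (s * s)" by blast
  with assms have eq: "p * s = r * q" by (simp add: eq_fract)
  then have "pderiv (p * s) = pderiv (r * q)" by simp
  then have d: "p * pderiv s + s * pderiv p = r * pderiv q + q * pderiv r"
    by (simp add: pderiv_mult)
  have "(pderiv p * q - p * pderiv q) * (s * s)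
      = q * s * (p * pderiv s + s * pderiv p) - (p * s) * (q * pderiv s + s * pderiv q)"
    by (simp add: algebra_simps)
  also have "\<dots> = (pderiv r * s - r * pderiv s) * (q * q)"
    unfolding d eq by (simp add: algebra_simps)
  finally show "g = Fract (pderiv p * q - p * pderiv q) (q * q)"
    using nz assms by (simp add: g eq_fract)
qed

text \<open>Here \<open>Der K[t]\<close> is identified with \<open>K[t]\<close>, a polynomial \<open>f\<close> standing for \<open>f d/dt\<close>.
  The case \<open>K = \<real>\<close> or \<open>K = \<complex>\<close> is expressed by the class \<open>real_normed_field\<close>: by the Gelfand-Mazur
  theorem, its instances are, up to isomorphism, exactly these two fields.\<close>

definition poly_action ::
  "('k::field \<Rightarrow> 'g::ab_group_add \<Rightarrow> 'g) \<Rightarrow> ('g \<Rightarrow> 'g \<Rightarrow> 'g) \<Rightarrow> ('g \<Rightarrow> 'k poly) \<Rightarrow> bool" where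
  "poly_action smul bracket \<theta> \<longleftrightarrow>
     Vector_Spaces.linear smul smult \<theta> \<and>
     (\<forall>X Y. \<theta> (bracket X Y) = \<theta> X * pderiv (\<theta> Y) - pderiv (\<theta> X) * \<theta> Y)"

definition basis_family :: "('k::field \<Rightarrow> 'g::ab_group_add \<Rightarrow> 'g) \<Rightarrow> ('n::finite \<Rightarrow> 'g) \<Rightarrow> bool" where
  "basis_family smul b \<longleftrightarrow>
     inj b \<and> \<not> module.dependent smul (range b) \<and> module.span smul (range b) = UNIV"

text \<open>By means of a basis \<open>b\<close> of the Lie algebra \<open>\<gg>\<close>, the tensor product \<open>K(t) \<otimes> \<gg>\<close> is \<open>K(t)\<^sup>n\<close>, with
  \<open>1 \<otimes> b i\<close> the \<open>i\<close>-th unit vector, and \<open>K(t) \<otimes> \<and>\<^sup>k\<gg>\<close> is the \<open>k\<close>-th exterior power of \<open>K(t)\<^sup>n\<close>.\<close>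

definition tensor ::
  "('k::field \<Rightarrow> 'g::ab_group_add \<Rightarrow> 'g) \<Rightarrow> ('n::finite \<Rightarrow> 'g) \<Rightarrow> 'k poly fract \<Rightarrow> 'g \<Rightarrow>
   'k poly fract ^ 'n" where
  "tensor smul b f X =
     (\<chi> i. f * const_rat (module.representation smul (range b) X (b i)))"

definition crossed_theta ::
  "('n::finite \<Rightarrow> 'g) \<Rightarrow> ('g \<Rightarrow> 'k::field poly) \<Rightarrow> 'k poly fract ^ 'n \<Rightarrow> 'k poly fract" where
  "crossed_theta b \<theta> u = (\<Sum>i\<in>UNIV. u $ i * to_rat (\<theta> (b i)))"

definition crossed_anchor ::
  "('n::finite \<Rightarrow> 'g) \<Rightarrow> ('g \<Rightarrow> 'k::field poly) \<Rightarrow> 'k poly fract ^ 'n \<Rightarrow>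
   'k poly fract \<Rightarrow> 'k poly fract" where
  "crossed_anchor b \<theta> u f = crossed_theta b \<theta> u * rat_deriv f"

text \<open>The crossed product bracket is the biadditive map given by its formula on the tensors
  \<open>u\<^sub>i \<otimes> b i\<close>; the formula for arbitrary tensors is derived below.\<close>

definition crossed_bracket ::
  "('k::field \<Rightarrow> 'g::ab_group_add \<Rightarrow> 'g) \<Rightarrow> ('g \<Rightarrow> 'g \<Rightarrow> 'g) \<Rightarrow> ('n::finite \<Rightarrow> 'g) \<Rightarrow>
   ('g \<Rightarrow> 'k poly) \<Rightarrow> 'k poly fract ^ 'n \<Rightarrow> 'k poly fract ^ 'n \<Rightarrow> 'k poly fract ^ 'n" where
  "crossed_bracket smul bracket b \<theta> u v =
     (\<Sum>i\<in>UNIV. \<Sum>j\<in>UNIV.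
        tensor smul b (u $ i * v $ j) (bracket (b i) (b j))
        + tensor smul b (u $ i * (to_rat (\<theta> (b i)) * rat_deriv (v $ j))) (b j)
        - tensor smul b (v $ j * (to_rat (\<theta> (b j)) * rat_deriv (u $ i))) (b i))"

lemma tensor_add_left: "tensor smul b (f + g) X = tensor smul b f X + tensor smul b g X"
  by (simp add: tensor_def vec_eq_iff algebra_simps)

lemma tensor_0_left: "tensor smul b 0 X = 0"
  by (simp add: tensor_def vec_eq_iff)

lemma tensor_sum_left: "tensor smul b (\<Sum>i\<in>S. f i) X = (\<Sum>i\<in>S. tensor smul b (f i) X)"
  by (induction S rule: infinite_finite_induct) (simp_all add: tensor_0_left tensor_add_left)

lemma to_rat_add: "to_rat (p + q) = to_rat p + to_rat q"
  by (simp add: to_rat_def)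

lemma to_rat_0: "to_rat 0 = 0"
  by (simp add: to_rat_def Zero_fract_def)

lemma to_rat_mult: "to_rat (p * q) = to_rat p * to_rat q"
  by (simp add: to_rat_def)

lemma to_rat_sum: "to_rat (\<Sum>i\<in>S. f i) = (\<Sum>i\<in>S. to_rat (f i))"
  by (induction S rule: infinite_finite_induct) (simp_all add: to_rat_add to_rat_0)

lemma to_rat_smult: "to_rat (smult c p) = const_rat c * to_rat p"
  using to_rat_mult[of "[:c:]" p] by (simp add: const_rat_def)

lemma const_rat_add: "const_rat (c + d) = const_rat c + const_rat d"
  using to_rat_add[of "[:c:]" "[:d:]"] by (simp add: const_rat_def)

lemma const_rat_mult: "const_rat (c * d) = const_rat c * const_rat d"
  using to_rat_mult[of "[:c:]" "[:d:]"] by (simp add: const_rat_def mult.commute)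

lemma rat_deriv_mult_const: "rat_deriv (f * const_rat c) = rat_deriv f * const_rat c"
proof (cases f)
  case (Fract p q)
  then show ?thesis
    by (simp add: const_rat_def to_rat_def rat_deriv_Fract eq_fract pderiv_mult algebra_simps
        pderiv_smult smult_diff_right)
qed

context
  fixes smul :: "'k::field \<Rightarrow> 'g::ab_group_add \<Rightarrow> 'g" and bracket and b :: "'n::finite \<Rightarrow> 'g"
    and \<theta> :: "'g \<Rightarrow> 'k poly"
  assumes lie: "lie_algebra smul bracket" and basis: "basis_family smul b"
    and action: "poly_action smul bracket \<theta>"
begin

interpretation lie_algebra smul bracket by (fact lie)

lemma basis_facts: "inj b" "independent (range b)" "span (range b) = UNIV"
  using basis by (auto simp: basis_family_def)

lemma tensor_add_right: "tensor smul b f (X + Y) = tensor smul b f X + tensor smul b f Y"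
  using basis_facts
  by (simp add: tensor_def vec_eq_iff representation_add const_rat_add algebra_simps)

lemma tensor_scale_right: "tensor smul b f (smul c X) = tensor smul b (f * const_rat c) X"
  using basis_facts
  by (simp add: tensor_def vec_eq_iff representation_scale const_rat_mult algebra_simps)

lemma tensor_0_right: "tensor smul b f 0 = 0"
  using tensor_add_right[of f 0 0] by simp

lemma tensor_sum_right: "tensor smul b f (\<Sum>i\<in>S. X i) = (\<Sum>i\<in>S. tensor smul b f (X i))"
  by (induction S rule: infinite_finite_induct) (simp_all add: tensor_0_right tensor_add_right)

lemma basis_expansion:
  "(\<Sum>i\<in>UNIV. smul (representation (range b) X (b i)) (b i)) = X"
proof -
  have "(\<Sum>v\<in>range b. smul (representation (range b) X v) v) = X"
    using basis_facts by (intro sum_representation_eq) auto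
  then show ?thesis
    using basis_facts(1) by (simp add: sum.reindex)
qed

lemma crossed_theta_tensor: "crossed_theta b \<theta> (tensor smul b f X) = f * to_rat (\<theta> X)"
proof -
  interpret t: Vector_Spaces.linear smul smult \<theta>
    using action by (simp add: poly_action_def)
  have "to_rat (\<theta> X) = to_rat (\<theta> (\<Sum>i\<in>UNIV. smul (representation (range b) X (b i)) (b i)))"
    by (simp only: basis_expansion)
  also have "\<dots> = (\<Sum>i\<in>UNIV. const_rat (representation (range b) X (b i)) * to_rat (\<theta> (b i)))"
    by (simp add: t.sum t.scale to_rat_sum to_rat_smult)
  finally show ?thesis
    by (simp add: crossed_theta_def tensor_def sum_distrib_left mult.assoc)
qed

lemma bracket_expansion:
  "bracket X Y = (\<Sum>i\<in>UNIV. \<Sum>j\<in>UNIV.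
     smul (representation (range b) X (b i) * representation (range b) Y (b j))
       (bracket (b i) (b j)))"
proof -
  interpret l: Vector_Spaces.linear smul smul "\<lambda>x. bracket x w" for w
    by (fact bracket_linear_left)
  interpret r: Vector_Spaces.linear smul smul "\<lambda>y. bracket w y" for w
    by (fact bracket_linear_right)
  let ?x = "\<lambda>i. representation (range b) X (b i)" and ?y = "\<lambda>i. representation (range b) Y (b i)"
  have "bracket X Y = bracket (\<Sum>i\<in>UNIV. smul (?x i) (b i)) (\<Sum>j\<in>UNIV. smul (?y j) (b j))"
    by (simp only: basis_expansion)
  also have "\<dots> = (\<Sum>i\<in>UNIV. smul (?x i) (\<Sum>j\<in>UNIV. smul (?y j) (bracket (b i) (b j))))"
    by (simp only: l.sum l.scale) (simp only: r.sum r.scale)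
  finally show ?thesis by (simp only: scale_sum_right scale_scale)
qed

lemma crossed_bracket_tensor:
  "crossed_bracket smul bracket b \<theta> (tensor smul b f X) (tensor smul b g Y) =
     tensor smul b (f * g) (bracket X Y)
     + tensor smul b (f * (to_rat (\<theta> X) * rat_deriv g)) Y
     - tensor smul b (g * (to_rat (\<theta> Y) * rat_deriv f)) X"
proof -
  define x where "x i = representation (range b) X (b i)" for i
  define y where "y i = representation (range b) Y (b i)" for i
  have tx: "tensor smul b f X $ i = f * const_rat (x i)" for i by (simp add: tensor_def x_def)
  have ty: "tensor smul b g Y $ i = g * const_rat (y i)" for i by (simp add: tensor_def y_def)
  have 1: "(\<Sum>i\<in>UNIV. \<Sum>j\<in>UNIV. tensor smul b (f * const_rat (x i) * (g * const_rat (y j)))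
             (bracket (b i) (b j))) = tensor smul b (f * g) (bracket X Y)"
    by (subst (2) bracket_expansion)
      (simp add: tensor_sum_right tensor_scale_right const_rat_mult x_def y_def ac_simps)
  have ex: "(\<Sum>j\<in>UNIV. tensor smul b (h * const_rat (y j)) (b j)) = tensor smul b h Y" for h
    using arg_cong[OF basis_expansion[of Y], of "tensor smul b h"]
    by (simp only: tensor_sum_right tensor_scale_right y_def)
  have ex': "(\<Sum>j\<in>UNIV. tensor smul b (h * const_rat (x j)) (b j)) = tensor smul b h X" for h
    using arg_cong[OF basis_expansion[of X], of "tensor smul b h"]
    by (simp only: tensor_sum_right tensor_scale_right x_def)
  have th: "f * to_rat (\<theta> X) = (\<Sum>i\<in>UNIV. f * const_rat (x i) * to_rat (\<theta> (b i)))"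
    "g * to_rat (\<theta> Y) = (\<Sum>i\<in>UNIV. g * const_rat (y i) * to_rat (\<theta> (b i)))"
    using crossed_theta_tensor[of f X] crossed_theta_tensor[of g Y]
    by (simp_all only: crossed_theta_def tx ty)
  have "(\<Sum>j\<in>UNIV. tensor smul b (f * const_rat (x i) *
           (to_rat (\<theta> (b i)) * (rat_deriv g * const_rat (y j)))) (b j)) =
        tensor smul b (f * const_rat (x i) * to_rat (\<theta> (b i)) * rat_deriv g) Y" for i
    unfolding ex[symmetric] by (simp add: ac_simps)
  then have 2: "(\<Sum>i\<in>UNIV. \<Sum>j\<in>UNIV. tensor smul b (f * const_rat (x i) *
             (to_rat (\<theta> (b i)) * (rat_deriv g * const_rat (y j)))) (b j)) =
           tensor smul b (f * (to_rat (\<theta> X) * rat_deriv g)) Y"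
    unfolding mult.assoc[of f "to_rat (\<theta> X)", symmetric] th(1) sum_distrib_right tensor_sum_left
    by simp
  have "(\<Sum>i\<in>UNIV. tensor smul b (g * const_rat (y j) *
           (to_rat (\<theta> (b j)) * (rat_deriv f * const_rat (x i)))) (b i)) =
        tensor smul b (g * const_rat (y j) * to_rat (\<theta> (b j)) * rat_deriv f) X" for j
    unfolding ex'[symmetric] by (simp add: ac_simps)
  then have 3: "(\<Sum>i\<in>UNIV. \<Sum>j\<in>UNIV. tensor smul b (g * const_rat (y j) *
             (to_rat (\<theta> (b j)) * (rat_deriv f * const_rat (x i)))) (b i)) =
           tensor smul b (g * (to_rat (\<theta> Y) * rat_deriv f)) X"
    unfolding mult.assoc[of g "to_rat (\<theta> Y)", symmetric] th(2) sum_distrib_right tensor_sum_left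
    by (subst sum.swap) simp
  show ?thesis
    unfolding crossed_bracket_def tx ty rat_deriv_mult_const sum_subtractf sum.distrib 1 2 3 ..
qed

end

definition crossed_schouten ::
  "('k::field \<Rightarrow> 'g::ab_group_add \<Rightarrow> 'g) \<Rightarrow> ('g \<Rightarrow> 'g \<Rightarrow> 'g) \<Rightarrow> ('n::{finite,linorder} \<Rightarrow> 'g) \<Rightarrow>
   ('g \<Rightarrow> 'k poly) \<Rightarrow> ('k poly fract, 'n) ext \<Rightarrow> ('k poly fract, 'n) ext \<Rightarrow>
   ('k poly fract, 'n) ext" where
  "crossed_schouten smul bracket b \<theta> =
     schouten const_rat (crossed_bracket smul bracket b \<theta>) (crossed_anchor b \<theta>)"

definition crossed_bialgebras ::
  "('k::field \<Rightarrow> 'g::ab_group_add \<Rightarrow> 'g) \<Rightarrow> ('g \<Rightarrow> 'g \<Rightarrow> 'g) \<Rightarrow> ('n::{finite,linorder} \<Rightarrow> 'g) \<Rightarrow>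
   ('g \<Rightarrow> 'k poly) \<Rightarrow> (('k poly fract, 'n) ext \<Rightarrow> ('k poly fract, 'n) ext) set" where
  "crossed_bialgebras smul bracket b \<theta> =
     {\<sigma>. lie_rinehart_bialgebra const_rat (crossed_bracket smul bracket b \<theta>)
            (crossed_anchor b \<theta>) \<sigma>}"


section \<open>Compatible pairs\<close>

definition kernel_square ::
  "('n::{finite,linorder} \<Rightarrow> 'g) \<Rightarrow> ('g \<Rightarrow> 'k::field poly) \<Rightarrow> ('k poly fract, 'n) ext set" where
  "kernel_square b \<theta> =
     vec.span {ext_vector x \<^bold>\<and> ext_vector y | x y.
                 crossed_theta b \<theta> x = 0 \<and> crossed_theta b \<theta> y = 0}"

definition lie_vector ::
  "('k::field \<Rightarrow> 'g::ab_group_add \<Rightarrow> 'g) \<Rightarrow> ('n::finite \<Rightarrow> 'g) \<Rightarrow> 'g \<Rightarrow> ('k poly fract, 'n) ext" where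
  "lie_vector smul b X = ext_vector (tensor smul b 1 X)"

definition is_cocycle ::
  "('k::field \<Rightarrow> 'g::ab_group_add \<Rightarrow> 'g) \<Rightarrow> ('g \<Rightarrow> 'g \<Rightarrow> 'g) \<Rightarrow> ('n::{finite,linorder} \<Rightarrow> 'g) \<Rightarrow>
   ('g \<Rightarrow> 'k poly) \<Rightarrow> ('g \<Rightarrow> ('k poly fract, 'n) ext) \<Rightarrow> bool" where
  "is_cocycle smul bracket b \<theta> \<Omega> \<longleftrightarrow>
     (\<forall>X Y. \<Omega> (bracket X Y) =
        crossed_schouten smul bracket b \<theta> (\<Omega> X) (lie_vector smul b Y)
        + crossed_schouten smul bracket b \<theta> (lie_vector smul b X) (\<Omega> Y))"

text \<open>The extension of \<open>\<Omega>\<close> is the \<open>K(t)\<close>-linear map which sends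
  \<open>e\<^sub>I = e\<^bsub>i\<^sub>1\<^esub> \<and> \<dots> \<and> e\<^bsub>i\<^sub>k\<^esub>\<close>, where \<open>i\<^sub>1 < \<dots> < i\<^sub>k\<close> and \<open>e\<^sub>i = 1 \<otimes> b i\<close>, to the sum over \<open>r\<close> of
  \<open>(-1)\<^bsup>r + 1\<^esup> e\<^bsub>i\<^sub>1\<^esub> \<and> \<dots> \<and> \<Omega>(b i\<^sub>r) \<and> \<dots> \<and> e\<^bsub>i\<^sub>k\<^esub>\<close>; if \<open>i = i\<^sub>r\<close>, then \<open>r - 1\<close> is the
  number of elements of \<open>I\<close> below \<open>i\<close>.\<close>

definition extend ::
  "('n::{finite,linorder} \<Rightarrow> 'g) \<Rightarrow> ('g \<Rightarrow> ('k::field poly fract, 'n) ext) \<Rightarrow>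
   ('k poly fract, 'n) ext \<Rightarrow> ('k poly fract, 'n) ext" where
  "extend b \<Omega> w =
     (\<Sum>I\<in>UNIV. w $ I *s
        (\<Sum>i\<in>I. (-1) ^ card {j\<in>I. j < i} *s
           (monomial {j\<in>I. j < i} \<^bold>\<and> \<Omega> (b i) \<^bold>\<and> monomial {j\<in>I. i < j})))"

definition compatible_pairs ::
  "('k::field \<Rightarrow> 'g::ab_group_add \<Rightarrow> 'g) \<Rightarrow> ('g \<Rightarrow> 'g \<Rightarrow> 'g) \<Rightarrow> ('n::{finite,linorder} \<Rightarrow> 'g) \<Rightarrow>
   ('g \<Rightarrow> 'k poly) \<Rightarrow> (('k poly fract, 'n) ext \<times> ('g \<Rightarrow> ('k poly fract, 'n) ext)) set" where
  "compatible_pairs smul bracket b \<theta> =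
     {(\<Lambda>, \<Omega>).
        \<Lambda> \<in> ext_power 2 \<and>
        Vector_Spaces.linear smul (\<lambda>c w. const_rat c *s w) \<Omega> \<and>
        range \<Omega> \<subseteq> kernel_square b \<theta> \<and>
        is_cocycle smul bracket b \<theta> \<Omega> \<and>
        (\<forall>x. crossed_schouten smul bracket b \<theta>
               ((1 / 2) *s crossed_schouten smul bracket b \<theta> \<Lambda> \<Lambda> + extend b \<Omega> \<Lambda>) (ext_vector x)
             + extend b \<Omega> (extend b \<Omega> (ext_vector x)) = 0)}"

definition equivalent_pairs ::
  "('k::field \<Rightarrow> 'g::ab_group_add \<Rightarrow> 'g) \<Rightarrow> ('g \<Rightarrow> 'g \<Rightarrow> 'g) \<Rightarrow> ('n::{finite,linorder} \<Rightarrow> 'g) \<Rightarrow>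
   ('g \<Rightarrow> 'k poly) \<Rightarrow> (('k poly fract, 'n) ext \<times> ('g \<Rightarrow> ('k poly fract, 'n) ext)) rel" where
  "equivalent_pairs smul bracket b \<theta> =
     {((\<Lambda>, \<Omega>), (\<Lambda>', \<Omega>')).
        (\<Lambda>, \<Omega>) \<in> compatible_pairs smul bracket b \<theta> \<and>
        (\<Lambda>', \<Omega>') \<in> compatible_pairs smul bracket b \<theta> \<and>
        (\<exists>\<nu>\<in>kernel_square b \<theta>. \<Lambda>' = \<Lambda> + \<nu> \<and>
           (\<forall>X. \<Omega>' X = \<Omega> X - crossed_schouten smul bracket b \<theta> \<nu> (lie_vector smul b X)))}"

definition pair_operator ::
  "('k::field \<Rightarrow> 'g::ab_group_add \<Rightarrow> 'g) \<Rightarrow> ('g \<Rightarrow> 'g \<Rightarrow> 'g) \<Rightarrow> ('n::{finite,linorder} \<Rightarrow> 'g) \<Rightarrow>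
   ('g \<Rightarrow> 'k poly) \<Rightarrow> ('k poly fract, 'n) ext \<Rightarrow> ('g \<Rightarrow> ('k poly fract, 'n) ext) \<Rightarrow>
   ('k poly fract, 'n) ext \<Rightarrow> ('k poly fract, 'n) ext" where
  "pair_operator smul bracket b \<theta> \<Lambda> \<Omega> =
     (\<lambda>w. crossed_schouten smul bracket b \<theta> \<Lambda> w + extend b \<Omega> w)"


end

(*
  Since a derivation of the exterior algebra is determined on functions and on E, the Schouten
  bracket can be written down as a derivation in its second argument, and its Jacobi identity (as
  well as every other derivation property of brackets) reduces to generators.

  Let d be a bialgebra operator on K(t) (x) g. On functions d is a derivation, so d f = f' d t, and
  applying d to [t, t] = 0 gives theta(d t) = 0. If theta(x0) = 1 and Lambda = - x0 /\ d t, then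
  [Lambda, .] agrees with d on functions. The remainder Omega = d - [Lambda, .] is K(t)-linear,
  and applying it to [X, f] shows that its values on E are annihilated by contraction with theta,
  i.e. lie in L^2. Finally d^2 = [[Lambda, Lambda] / 2 + Omega(Lambda), .] + Omega^2.
  Two pairs give the same operator iff nu = Lambda' - Lambda satisfies [nu, f] = 0 for functions f,
  i.e. nu lies in L^2, and Omega' = Omega - [nu, .].
*)
theory Submission
  imports Defs
begin

section \<open>The exterior algebra\<close>

text \<open>The Schouten bracket enters as a definite description, so nothing can be computed with
  it until a bracket with all its properties has been exhibited and shown to be the only one. Hence
  a formula in coordinates, its graded Jacobi identity and the Lie Rinehart axioms of the crossed
  product precede any work on bialgebras. The variable t suffices as a test function because a
  derivation from K(t) to a vector space over K(t) that kills constants is fixed by its value at t.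
  The vector x0 exists because a nonzero theta(X) is invertible in K(t). The sign of Lambda comes
  from [P, f] = - f' iota_theta P for bivectors P, where iota_theta is contraction with theta. As
  iota_theta(x0 \<and> d t) = theta(x0) d t - theta(d t) x0, the equation theta(d t) = 0 is what
  leaves d t alone. It first appears as 2 theta(d t) = 0; this and the factor 1/2 in the
  compatibility condition call for characteristic different from 2.\<close>

lemmas vs_simps = vector_add_ldistrib vector_sadd_rdistrib vector_smult_assoc
  vector_ssub_ldistrib vector_sub_rdistrib vector_smult_rneg vector_smult_lneg

lemma monomial_nth: "monomial I $ J = (if J = I then 1 else 0)"
  by (simp add: monomial_def axis_def)

lemma ext_expansion: "(\<Sum>I\<in>UNIV. w $ I *s monomial I) = (w :: ('a::comm_ring_1, 'n::finite) ext)"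
  unfolding monomial_def by (rule Finite_Cartesian_Product.basis_expansion)

lemma ext_lin_induct [case_names add scale monomial]:
  fixes w :: "('a::comm_ring_1, 'n::finite) ext"
  assumes add: "\<And>u v. P u \<Longrightarrow> P v \<Longrightarrow> P (u + v)"
    and scale: "\<And>f u. P u \<Longrightarrow> P (f *s u)"
    and monomial: "\<And>I. P (monomial I)"
  shows "P w"
proof -
  have "P 0" using scale[OF monomial, of 0 "{}"] by simp
  then have "P (\<Sum>I\<in>S. w $ I *s monomial I)" for S
    by (induction S rule: infinite_finite_induct) (auto intro: assms)
  then show ?thesis by (metis ext_expansion)
qed

text \<open>Meant for maps that differentiate coefficients: they are not linear over A, so the
  coefficient has to stay inside \<open>F\<close>.\<close>

lemma additive_expansion:
  assumes "Modules.additive F"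
  shows "F w = (\<Sum>I\<in>UNIV. F (w $ I *s monomial I))"
  using Modules.additive.sum[OF assms, of "\<lambda>I. w $ I *s monomial I" UNIV] by (simp add: ext_expansion)

section \<open>Shuffle signs\<close>

lemma shuffle_sign_Un_left:
  fixes I J K :: "'n::{finite,linorder} set"
  assumes "I \<inter> J = {}"
  shows "shuffle_sign (I \<union> J) K = shuffle_sign I K * (shuffle_sign J K :: 'a::comm_ring_1)"
proof -
  have "{(i, j). i \<in> I \<union> J \<and> j \<in> K \<and> j < i} =
      {(i, j). i \<in> I \<and> j \<in> K \<and> j < i} \<union> {(i, j). i \<in> J \<and> j \<in> K \<and> j < i}" by auto
  then show ?thesis
    using assms unfolding shuffle_sign_def power_add[symmetric]
    by (subst card_Un_disjoint[symmetric]) auto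
qed

lemma shuffle_sign_Un_right:
  fixes I J K :: "'n::{finite,linorder} set"
  assumes "J \<inter> K = {}"
  shows "shuffle_sign I (J \<union> K) = shuffle_sign I J * (shuffle_sign I K :: 'a::comm_ring_1)"
proof -
  have "{(i, j). i \<in> I \<and> j \<in> J \<union> K \<and> j < i} =
      {(i, j). i \<in> I \<and> j \<in> J \<and> j < i} \<union> {(i, j). i \<in> I \<and> j \<in> K \<and> j < i}" by auto
  then show ?thesis
    using assms unfolding shuffle_sign_def power_add[symmetric]
    by (subst card_Un_disjoint[symmetric]) auto
qed

lemma shuffle_sign_square: "shuffle_sign I J * (shuffle_sign I J * x) = (x :: 'a::comm_ring_1)"
  by (simp add: shuffle_sign_def flip: mult.assoc power_add)

lemma shuffle_sign_square': "shuffle_sign I J * shuffle_sign I J = (1 :: 'a::comm_ring_1)"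
  using shuffle_sign_square[of I J 1] by simp

text \<open>Each pair in I x J is an inversion for exactly one of the two orders, so the two
  inversion numbers add up to \<open>card I * card J\<close>.\<close>

lemma shuffle_sign_swap:
  fixes I J :: "'n::{finite,linorder} set"
  assumes "I \<inter> J = {}"
  shows "shuffle_sign I J = (-1) ^ (card I * card J) * (shuffle_sign J I :: 'a::comm_ring_1)"
proof -
  let ?A = "{(i, j). i \<in> I \<and> j \<in> J \<and> j < i}" and ?B = "{(i, j). i \<in> I \<and> j \<in> J \<and> i < j}"
  have "?A \<union> ?B = I \<times> J"
    using assms by (auto simp: disjoint_iff) (metis linorder_neqE)
  then have "card I * card J = card (?A \<union> ?B)"
    by (simp only: card_cartesian_product)
  also have "\<dots> = card ?A + card ?B"
    by (rule card_Un_disjoint) auto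
  finally have "card I * card J = card ?A + card ?B" .
  moreover have "card {(j, i). j \<in> J \<and> i \<in> I \<and> i < j} = card ?B" (is "card ?C = _")
  proof -
    have "?C = prod.swap ` ?B" by auto
    then show ?thesis by (simp only: card_image inj_swap)
  qed
  moreover have "(-1) ^ card ?A = (-1) ^ card ?A * (-1) ^ card ?B * ((-1) ^ card ?B :: 'a)"
    by (simp add: mult.assoc flip: power_mult_distrib)
  ultimately show ?thesis
    by (simp only: shuffle_sign_def power_add)
qed

lemma shuffle_sign_empty [simp]: "shuffle_sign {} J = 1" "shuffle_sign I {} = 1"
  by (simp_all add: shuffle_sign_def)

lemma shuffle_sign_singleton: "shuffle_sign {i} J = (-1) ^ card {j\<in>J. j < i}"
proof -
  have "{(i', j). i' \<in> {i} \<and> j \<in> J \<and> j < i'} = Pair i ` {j\<in>J. j < i}" by auto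
  then show ?thesis by (simp add: shuffle_sign_def card_image inj_on_def)
qed

lemma shuffle_sign_ordered:
  assumes "\<And>i j. i \<in> I \<Longrightarrow> j \<in> J \<Longrightarrow> i < j"
  shows "shuffle_sign I J = 1"
proof -
  have "{(i, j). i \<in> I \<and> j \<in> J \<and> j < i} = {}" using assms by (auto dest: less_asym)
  then show ?thesis unfolding shuffle_sign_def by (simp only: card.empty power_0)
qed

section \<open>The wedge product: bilinearity, associativity, unit\<close>

lemma wedge_add_left: "(u + v) \<^bold>\<and> w = u \<^bold>\<and> w + v \<^bold>\<and> w"
  by (simp add: wedge_def vec_eq_iff algebra_simps sum.distrib)

lemma wedge_add_right: "w \<^bold>\<and> (u + v) = w \<^bold>\<and> u + w \<^bold>\<and> v"
  by (simp add: wedge_def vec_eq_iff algebra_simps sum.distrib)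

lemma wedge_scale_left: "(f *s u) \<^bold>\<and> w = f *s (u \<^bold>\<and> w)"
  by (simp add: wedge_def vec_eq_iff sum_distrib_left ac_simps)

lemma wedge_scale_right: "u \<^bold>\<and> (f *s w) = f *s (u \<^bold>\<and> w)"
  by (simp add: wedge_def vec_eq_iff sum_distrib_left ac_simps)

interpretation wedge_left: Modules.additive "\<lambda>u. u \<^bold>\<and> w" for w by unfold_locales (rule wedge_add_left)
interpretation wedge_right: Modules.additive "\<lambda>u. w \<^bold>\<and> u" for w by unfold_locales (rule wedge_add_right)

lemmas wedge_linear_simps = wedge_add_left wedge_add_right wedge_scale_left wedge_scale_right
  wedge_left.zero wedge_right.zero wedge_left.minus wedge_right.minus
  wedge_left.diff wedge_right.diff

lemma wedge_monomial:
  "monomial I \<^bold>\<and> monomial J =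
     (if I \<inter> J = {} then shuffle_sign I J *s monomial (I \<union> J) else 0)"
proof (rule vec_eq_iff[THEN iffD2], rule allI)
  fix K
  have "(monomial I \<^bold>\<and> monomial J) $ K =
      (\<Sum>M\<in>Pow K. if M = I then (if K - I = J then shuffle_sign I J else 0) else 0)"
    unfolding wedge_def vec_lambda_beta by (rule sum.cong) (simp_all add: monomial_nth)
  also have "\<dots> = (if I \<subseteq> K \<and> K - I = J then shuffle_sign I J else 0)"
    by (simp add: sum.delta)
  also have "I \<subseteq> K \<and> K - I = J \<longleftrightarrow> I \<inter> J = {} \<and> K = I \<union> J" by blast
  finally show "(monomial I \<^bold>\<and> monomial J) $ K =
      (if I \<inter> J = {} then shuffle_sign I J *s monomial (I \<union> J) else 0) $ K"
    by (cases "K = I \<union> J") (simp_all add: monomial_nth)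
qed

text \<open>By trilinearity only monomials matter, and there both sides carry the product of the
  three pairwise shuffle signs.\<close>

lemma wedge_assoc: "(u \<^bold>\<and> v) \<^bold>\<and> w = u \<^bold>\<and> (v \<^bold>\<and> w)"
proof (induction u rule: ext_lin_induct)
  case (monomial I)
  show ?case
  proof (induction v rule: ext_lin_induct)
    case (monomial J)
    show ?case
    proof (induction w rule: ext_lin_induct)
      case (monomial K)
      show ?case
        by (auto simp: wedge_monomial wedge_linear_simps vs_simps shuffle_sign_Un_left
            shuffle_sign_Un_right Int_Un_distrib Int_Un_distrib2 Un_assoc ac_simps)
    qed (simp_all add: wedge_linear_simps)
  qed (simp_all add: wedge_linear_simps)
qed (simp_all add: wedge_linear_simps)

lemma wedge_one_left [simp]: "monomial {} \<^bold>\<and> w = w"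
  by (induction w rule: ext_lin_induct) (simp_all add: wedge_linear_simps wedge_monomial)

lemma wedge_one_right [simp]: "w \<^bold>\<and> monomial {} = w"
  by (induction w rule: ext_lin_induct) (simp_all add: wedge_linear_simps wedge_monomial)

lemma ext_scalar_wedge [simp]: "ext_scalar f \<^bold>\<and> w = f *s w" "w \<^bold>\<and> ext_scalar f = f *s w"
  by (simp_all add: ext_scalar_def wedge_linear_simps)

text \<open>No pair is inverted when \<open>i\<close> lies below \<open>I\<close>. Splitting off the
  least index thus costs no sign, and every monomial arises from 1 by wedging with basis vectors on
  the left.\<close>

lemma monomial_min:
  assumes "\<And>j. j \<in> I \<Longrightarrow> i < j"
  shows "monomial (insert i I) = monomial {i} \<^bold>\<and> (monomial I :: ('a::comm_ring_1, 'n::{finite,linorder}) ext)"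
proof -
  have "shuffle_sign {i} I = (1 :: 'a)" using assms by (intro shuffle_sign_ordered) auto
  then show ?thesis using assms by (auto simp: wedge_monomial)
qed

lemma monomial_wedge_induct [case_names one wedge]:
  assumes "P (monomial {})"
    and "\<And>i I. (\<And>j. j \<in> I \<Longrightarrow> i < j) \<Longrightarrow> P (monomial I) \<Longrightarrow> P (monomial {i} \<^bold>\<and> monomial I)"
  shows "P (monomial (I :: 'n::{finite,linorder} set))"
  using finite[of I] by (induction I rule: finite_linorder_min_induct) (auto simp: monomial_min assms)

lemma wedge_nonzero:
  fixes u v :: "('a::comm_ring_1, 'n::{finite,linorder}) ext"
  assumes "(u \<^bold>\<and> v) $ K \<noteq> 0"
  obtains I J where "u $ I \<noteq> 0" "v $ J \<noteq> 0" "I \<inter> J = {}" "K = I \<union> J"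
proof -
  obtain I where "I \<in> Pow K" "shuffle_sign I (K - I) * u $ I * v $ (K - I) \<noteq> 0"
    using assms by (auto simp: wedge_def elim: sum.not_neutral_contains_not_neutral)
  then show ?thesis by (intro that[of I "K - I"]) auto
qed

text \<open>All signs depend only on the parity of degrees, so graded identities are stated for
  \<open>\<and>\<^bsup>even\<^esup>\<close> and \<open>\<and>\<^bsup>odd\<^esup>\<close> instead of the single exterior powers.\<close>

definition parity_part :: "nat \<Rightarrow> ('a::comm_ring_1, 'n::finite) ext set" where
  "parity_part p = {w. \<forall>I. w $ I \<noteq> 0 \<longrightarrow> even (card I + p)}"

lemma ext_power_parity: "ext_power k \<subseteq> parity_part k"
  by (auto simp: ext_power_def parity_part_def)

lemma ext_power_linear:
  fixes u v :: "('a::comm_ring_1, 'b::finite) ext"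
  shows
  "(0 :: ('a, 'b) ext) \<in> ext_power k"
  "u \<in> ext_power k \<Longrightarrow> v \<in> ext_power k \<Longrightarrow> u + v \<in> ext_power k"
  "u \<in> ext_power k \<Longrightarrow> v \<in> ext_power k \<Longrightarrow> u - v \<in> ext_power k"
  "u \<in> ext_power k \<Longrightarrow> - u \<in> ext_power k"
  "u \<in> ext_power k \<Longrightarrow> f *s u \<in> ext_power k"
proof -
  have ext_power: "w \<in> ext_power k \<longleftrightarrow> (\<forall>I. card I \<noteq> k \<longrightarrow> w $ I = 0)"
    for w :: "('a, 'b::finite) ext"
    unfolding ext_power_def by blast
  show "(0 :: ('a, 'b) ext) \<in> ext_power k"
    "u \<in> ext_power k \<Longrightarrow> v \<in> ext_power k \<Longrightarrow> u + v \<in> ext_power k"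
    "u \<in> ext_power k \<Longrightarrow> v \<in> ext_power k \<Longrightarrow> u - v \<in> ext_power k"
    "u \<in> ext_power k \<Longrightarrow> - u \<in> ext_power k"
    "u \<in> ext_power k \<Longrightarrow> f *s u \<in> ext_power k"
    by (simp_all add: ext_power)
qed

lemma ext_power_sum: "(\<And>i. i \<in> S \<Longrightarrow> u i \<in> ext_power k) \<Longrightarrow> (\<Sum>i\<in>S. u i) \<in> ext_power k"
  by (induction S rule: infinite_finite_induct) (auto simp: ext_power_linear)

lemma parity_part_linear:
  fixes u v :: "('a::comm_ring_1, 'b::finite) ext"
  shows
  "(0 :: ('a, 'b) ext) \<in> parity_part k"
  "u \<in> parity_part k \<Longrightarrow> v \<in> parity_part k \<Longrightarrow> u + v \<in> parity_part k"
  "u \<in> parity_part k \<Longrightarrow> v \<in> parity_part k \<Longrightarrow> u - v \<in> parity_part k"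
  "u \<in> parity_part k \<Longrightarrow> - u \<in> parity_part k"
  "u \<in> parity_part k \<Longrightarrow> f *s u \<in> parity_part k"
proof -
  have parity_part: "w \<in> parity_part k \<longleftrightarrow> (\<forall>I. odd (card I + k) \<longrightarrow> w $ I = 0)"
    for w :: "('a, 'b::finite) ext"
    unfolding parity_part_def by blast
  show "(0 :: ('a, 'b) ext) \<in> parity_part k"
    "u \<in> parity_part k \<Longrightarrow> v \<in> parity_part k \<Longrightarrow> u + v \<in> parity_part k"
    "u \<in> parity_part k \<Longrightarrow> v \<in> parity_part k \<Longrightarrow> u - v \<in> parity_part k"
    "u \<in> parity_part k \<Longrightarrow> - u \<in> parity_part k"
    "u \<in> parity_part k \<Longrightarrow> f *s u \<in> parity_part k"
    by (simp_all add: parity_part del: even_add)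
qed

lemma parity_part_cong: "even (p + q) \<Longrightarrow> u \<in> parity_part p \<Longrightarrow> u \<in> parity_part q"
  by (auto simp: parity_part_def)

lemma monomial_ext_power: "card I = k \<Longrightarrow> monomial I \<in> ext_power k"
  by (simp add: ext_power_def monomial_nth)

lemma monomial_parity_part: "even (card I + p) \<Longrightarrow> monomial I \<in> parity_part p"
  by (simp add: parity_part_def monomial_nth)

lemma ext_scalar_power: "ext_scalar f \<in> ext_power 0"
  by (simp add: ext_scalar_def ext_power_linear monomial_ext_power)

lemma ext_vector_power: "ext_vector x \<in> ext_power 1"
  unfolding ext_vector_def by (intro ext_power_sum ext_power_linear monomial_ext_power) simp

lemma wedge_ext_power:
  assumes "u \<in> ext_power k" "v \<in> ext_power l"
  shows "u \<^bold>\<and> v \<in> ext_power (k + l)"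
  using assms
  by (fastforce simp: ext_power_def elim!: wedge_nonzero simp: card_Un_disjoint)

lemma wedge_parity_part:
  assumes "u \<in> parity_part p" "v \<in> parity_part q"
  shows "u \<^bold>\<and> v \<in> parity_part (p + q)"
  unfolding parity_part_def
proof (intro CollectI allI impI)
  fix K assume "(u \<^bold>\<and> v) $ K \<noteq> 0"
  then obtain I J where "u $ I \<noteq> 0" "v $ J \<noteq> 0" "I \<inter> J = {}" "K = I \<union> J"
    by (rule wedge_nonzero)
  moreover from this have "even (card I + p)" "even (card J + q)"
    using assms by (auto simp: parity_part_def)
  ultimately show "even (card K + (p + q))" by (auto simp: card_Un_disjoint)
qed

lemma neg_one_power_cong: "even (m + n) \<Longrightarrow> (-1) ^ m = ((-1) ^ n :: 'a::comm_ring_1)"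
  by (cases "even n") auto

text \<open>Coefficients at index sets of the wrong parity vanish; their terms are covered by
  \<open>P 0\<close>.\<close>

lemma parity_induct [consumes 1, case_names zero add single]:
  assumes "u \<in> parity_part p"
    and "P 0" "\<And>u v. u \<in> parity_part p \<Longrightarrow> v \<in> parity_part p \<Longrightarrow> P u \<Longrightarrow> P v \<Longrightarrow> P (u + v)"
    and "\<And>f I. even (card I + p) \<Longrightarrow> P (f *s monomial I)"
  shows "P u"
proof -
  have single: "u $ I *s monomial I \<in> parity_part p \<and> P (u $ I *s monomial I)" for I
  proof (cases "u $ I = 0")
    case False
    then have "even (card I + p)" using assms(1) by (auto simp: parity_part_def)
    then show ?thesis using assms(4) by (blast intro: parity_part_linear monomial_parity_part)
  qed (simp add: parity_part_linear assms(2))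
  have "(\<Sum>I\<in>S. u $ I *s monomial I) \<in> parity_part p \<and> P (\<Sum>I\<in>S. u $ I *s monomial I)" for S
    using single assms(2,3) 
    by (induction S rule: infinite_finite_induct) (simp_all add: parity_part_linear)
  then show ?thesis by (metis ext_expansion)
qed

lemma wedge_commute:
  assumes "u \<in> parity_part p" "v \<in> parity_part q"
  shows "u \<^bold>\<and> v = (-1) ^ (p * q) *s (v \<^bold>\<and> u)"
  using assms(1)
proof (induction rule: parity_induct)
  case (single f I)
  show ?case
    using assms(2)
  proof (induction rule: parity_induct)
    case (single g J)
    have "(-1) ^ (card I * card J) = ((-1) ^ (p * q) :: 'a)"
      using single \<open>even (card I + p)\<close> by (intro neg_one_power_cong) auto
    then show ?case
      using shuffle_sign_swap[of I J, where 'a = 'a]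
      by (auto simp: wedge_linear_simps wedge_monomial vs_simps Int_commute Un_commute ac_simps)
  qed (simp_all add: wedge_linear_simps vs_simps)
qed (simp_all add: wedge_linear_simps vs_simps)

section \<open>Graded derivations of the exterior algebra\<close>

text \<open>Only additivity is asked, since such maps differentiate functions. Only the parity of
  \<open>d\<close> matters, so [P, .] for P of degree p, which shifts degrees by p - 1, gets
  \<open>d\<close> = p + 1 and stays within the natural numbers.\<close>

definition wedge_derivation ::
  "nat \<Rightarrow> (('a::comm_ring_1, 'n::{finite,linorder}) ext \<Rightarrow> ('a, 'n) ext) \<Rightarrow> bool" where
  "wedge_derivation d \<sigma> \<longleftrightarrow> Modules.additive \<sigma> \<and>
     (\<forall>p. \<forall>x\<in>parity_part p. \<sigma> x \<in> parity_part (p + d)) \<and>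
     (\<forall>p. \<forall>x\<in>parity_part p. \<forall>y. \<sigma> (x \<^bold>\<and> y) = \<sigma> x \<^bold>\<and> y + (-1) ^ (d * p) *s (x \<^bold>\<and> \<sigma> y))"

text \<open>An even or odd element is a sum of terms f e_I, each of which lies in a single exterior
  power whose sign agrees with that of the parity. This links rules stated degree by degree with the
  parity calculus.\<close>

lemma wedge_derivationI:
  fixes \<sigma> :: "('a::comm_ring_1, 'n::{finite,linorder}) ext \<Rightarrow> ('a, 'n) ext"
  assumes additive: "Modules.additive \<sigma>"
    and par: "\<And>k x. x \<in> ext_power k \<Longrightarrow> \<sigma> x \<in> parity_part (k + d)"
    and leib: "\<And>k x y. x \<in> ext_power k \<Longrightarrow>
      \<sigma> (x \<^bold>\<and> y) = \<sigma> x \<^bold>\<and> y + (-1) ^ (d * k) *s (x \<^bold>\<and> \<sigma> y)"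
  shows "wedge_derivation d \<sigma>"
proof -
  interpret Modules.additive \<sigma> by (fact additive)
  have "\<sigma> x \<in> parity_part (p + d)" if "x \<in> parity_part p" for p x
    using that
  proof (induction rule: parity_induct)
    case (single f I)
    then have "\<sigma> (f *s monomial I) \<in> parity_part (card I + d)"
      by (intro par ext_power_linear monomial_ext_power) simp
    then show ?case by (rule parity_part_cong[rotated]) (use single in auto)
  qed (simp_all add: parity_part_linear add zero)
  moreover have "\<sigma> (x \<^bold>\<and> y) = \<sigma> x \<^bold>\<and> y + (-1) ^ (d * p) *s (x \<^bold>\<and> \<sigma> y)"
    if "x \<in> parity_part p" for p x y
    using that
  proof (induction rule: parity_induct)
    case (single f I)
    have "(-1) ^ (d * card I) = ((-1) ^ (d * p) :: 'a)"
      using single by (intro neg_one_power_cong) auto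
    then show ?case
      using leib[of "f *s monomial I" "card I" y] by (simp add: ext_power_linear monomial_ext_power)
  qed (simp_all add: wedge_linear_simps vs_simps add zero)
  ultimately show ?thesis by (simp add: wedge_derivation_def additive)
qed

lemma
  assumes "wedge_derivation d \<sigma>"
  shows wedge_derivation_additive: "Modules.additive \<sigma>"
    and wedge_derivation_parity: "x \<in> parity_part p \<Longrightarrow> \<sigma> x \<in> parity_part (p + d)"
    and wedge_derivation_wedge: "x \<in> parity_part p \<Longrightarrow>
      \<sigma> (x \<^bold>\<and> y) = \<sigma> x \<^bold>\<and> y + (-1) ^ (d * p) *s (x \<^bold>\<and> \<sigma> y)"
  using assms by (auto simp: wedge_derivation_def)

text \<open>A function acts as an element of degree 0, so a derivation is linear over A once it
  kills functions.\<close>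

lemma wedge_derivation_scale:
  assumes "wedge_derivation d \<sigma>"
  shows "\<sigma> (f *s w) = \<sigma> (ext_scalar f) \<^bold>\<and> w + f *s \<sigma> w"
  using wedge_derivation_wedge[OF assms subsetD[OF ext_power_parity ext_scalar_power], of f w]
  by simp

text \<open>Monomials are products of basis vectors. Applied to differences, this is the uniqueness
  principle behind almost every later identity: two derivations of equal parity agree once they
  agree on functions and basis vectors.\<close>

lemma wedge_derivation_eq_0:
  assumes \<sigma>: "wedge_derivation d \<sigma>"
    and scalar: "\<And>f. \<sigma> (ext_scalar f) = 0" and vector: "\<And>i. \<sigma> (monomial {i}) = 0"
  shows "\<sigma> w = 0"
proof (induction w rule: ext_lin_induct)
  case (monomial I)
  show ?case
  proof (induction I rule: monomial_wedge_induct)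
    case one
    show ?case using scalar[of 1] by (simp add: ext_scalar_def)
  next
    case (wedge i I)
    show ?case
      using wedge vector
      by (subst wedge_derivation_wedge[OF \<sigma>, of _ 1])
        (simp_all add: monomial_parity_part wedge_linear_simps)
  qed
qed (simp_all add: Modules.additive.add[OF wedge_derivation_additive[OF \<sigma>]] wedge_derivation_scale[OF \<sigma>]
    scalar wedge_linear_simps)

lemma additive_linear_combination:
  fixes \<sigma> \<tau> :: "('a::comm_ring_1, 'n::{finite,linorder}) ext \<Rightarrow> ('a, 'n) ext"
  assumes "Modules.additive \<sigma>" "Modules.additive \<tau>"
  shows "Modules.additive (\<lambda>x. \<sigma> x + \<tau> x)" "Modules.additive (\<lambda>x. \<sigma> x - \<tau> x)" "Modules.additive (\<lambda>x. c *s \<sigma> x)"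
    "Modules.additive (\<lambda>x. \<sigma> (\<tau> x))"
  using assms by (simp_all add: Modules.additive_def vs_simps)

lemma wedge_derivation_add:
  assumes "wedge_derivation d \<sigma>" "wedge_derivation d \<tau>"
  shows "wedge_derivation d (\<lambda>x. \<sigma> x + \<tau> x)"
  using assms
  by (auto simp: wedge_derivation_def additive_linear_combination parity_part_linear
      wedge_linear_simps vs_simps)

lemma wedge_derivation_sum:
  assumes "\<And>i. i \<in> S \<Longrightarrow> wedge_derivation d (\<sigma> i)"
  shows "wedge_derivation d (\<lambda>x. \<Sum>i\<in>S. \<sigma> i x)"
  using assms
proof (induction S rule: infinite_finite_induct)
  case (insert i S)
  then show ?case by (auto intro: wedge_derivation_add)
qed (simp_all add: wedge_derivation_def Modules.additive_def parity_part_linear wedge_linear_simps)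

lemma wedge_derivation_smult:
  assumes "wedge_derivation d \<sigma>"
  shows "wedge_derivation d (\<lambda>x. c *s \<sigma> x)"
  using assms
  by (auto simp: wedge_derivation_def Modules.additive_def parity_part_linear
      wedge_linear_simps vs_simps ac_simps)

lemma wedge_derivation_uminus:
  assumes "wedge_derivation d \<sigma>"
  shows "wedge_derivation d (\<lambda>x. - \<sigma> x)"
  using wedge_derivation_smult[OF assms, of "-1"] by (simp add: vs_simps)

lemma wedge_derivation_diff:
  assumes "wedge_derivation d \<sigma>" "wedge_derivation d \<tau>"
  shows "wedge_derivation d (\<lambda>x. \<sigma> x - \<tau> x)"
  using wedge_derivation_add[OF assms(1) wedge_derivation_uminus[OF assms(2)]] by simp

lemma wedge_derivation_cong:
  assumes "even (d + d')" "wedge_derivation d \<sigma>"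
  shows "wedge_derivation d' \<sigma>"
proof -
  have "(-1) ^ (d * p) = ((-1) ^ (d' * p) :: 'a)" for p
    using assms(1) by (intro neg_one_power_cong) auto
  moreover have "u \<in> parity_part (p + d')" if "u \<in> parity_part (p + d)" for u p
    using assms(1) by (intro parity_part_cong[OF _ that]) auto
  ultimately show ?thesis
    using assms(2) unfolding wedge_derivation_def by metis
qed

text \<open>Moving \<open>u\<close> past \<open>x\<close> costs (-1)^(k p), which is exactly the
  change of sign from \<open>d\<close> to \<open>k + d\<close>. The explicit bracket is assembled
  from contractions and coefficient derivatives in this way.\<close>

lemma wedge_derivation_left_wedge:
  fixes \<sigma> :: "('a::comm_ring_1, 'n::{finite,linorder}) ext \<Rightarrow> ('a, 'n) ext"
  assumes "u \<in> parity_part k" "wedge_derivation d \<sigma>"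
  shows "wedge_derivation (k + d) (\<lambda>x. u \<^bold>\<and> \<sigma> x)"
  unfolding wedge_derivation_def
proof (intro conjI allI ballI)
  show "Modules.additive (\<lambda>x. u \<^bold>\<and> \<sigma> x)"
    using wedge_derivation_additive[OF assms(2)] by (simp add: Modules.additive_def wedge_linear_simps)
  fix p and x :: "('a, 'n) ext" assume x: "x \<in> parity_part p"
  then show "u \<^bold>\<and> \<sigma> x \<in> parity_part (p + (k + d))"
    using wedge_parity_part[OF assms(1) wedge_derivation_parity[OF assms(2) x]]
    by (simp add: ac_simps)
  fix y
  have "u \<^bold>\<and> x \<^bold>\<and> \<sigma> y = (-1) ^ (k * p) *s (x \<^bold>\<and> (u \<^bold>\<and> \<sigma> y))"
    by (subst wedge_commute[OF assms(1) x]) (simp add: wedge_linear_simps wedge_assoc)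
  then show "u \<^bold>\<and> \<sigma> (x \<^bold>\<and> y) = u \<^bold>\<and> \<sigma> x \<^bold>\<and> y + (-1) ^ ((k + d) * p) *s (x \<^bold>\<and> (u \<^bold>\<and> \<sigma> y))"
    by (simp add: wedge_derivation_wedge[OF assms(2) x] wedge_linear_simps wedge_assoc vs_simps
        power_add algebra_simps)
qed

text \<open>The two cross terms in \<open>\<sigma> x\<close> and \<open>\<sigma> y\<close> have
  signs (-1)^(d (p + d)) and (-1)^(d p), which are opposite for odd \<open>d\<close>. Arguing
  directly avoids halving a graded commutator.\<close>

lemma wedge_derivation_square:
  fixes \<sigma> :: "('a::comm_ring_1, 'n::{finite,linorder}) ext \<Rightarrow> ('a, 'n) ext"
  assumes "wedge_derivation d \<sigma>" "odd d"
  shows "wedge_derivation (d + d) (\<lambda>x. \<sigma> (\<sigma> x))"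
  unfolding wedge_derivation_def
proof (intro conjI allI ballI)
  interpret Modules.additive \<sigma> using assms(1) by (rule wedge_derivation_additive)
  show "Modules.additive (\<lambda>x. \<sigma> (\<sigma> x))" by unfold_locales (simp add: add)
  fix p and x :: "('a, 'n) ext" assume x: "x \<in> parity_part p"
  note \<sigma>x = wedge_derivation_parity[OF assms(1) x]
  show "\<sigma> (\<sigma> x) \<in> parity_part (p + (d + d))"
    using wedge_derivation_parity[OF assms(1) \<sigma>x] by (simp add: ac_simps)
  fix y
  have sgn: "\<sigma> ((-1) ^ m *s w) = (-1) ^ m *s \<sigma> w" for m w
    by (cases "even m") (simp_all add: vs_simps minus)
  show "\<sigma> (\<sigma> (x \<^bold>\<and> y)) = \<sigma> (\<sigma> x) \<^bold>\<and> y + (-1) ^ ((d + d) * p) *s (x \<^bold>\<and> \<sigma> (\<sigma> y))"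
    using assms(2)
    by (cases "even p") (simp_all add: wedge_derivation_wedge[OF assms(1) x]
        wedge_derivation_wedge[OF assms(1) \<sigma>x] add diff sgn minus vs_simps)
qed

text \<open>The mixed terms, in which one map hits \<open>x\<close> and the other hits
  \<open>y\<close>, cancel in pairs.\<close>

lemma wedge_derivation_commutator:
  fixes \<sigma> \<tau> :: "('a::comm_ring_1, 'n::{finite,linorder}) ext \<Rightarrow> ('a, 'n) ext"
  assumes \<sigma>: "wedge_derivation d \<sigma>" and \<tau>: "wedge_derivation e \<tau>"
  shows "wedge_derivation (d + e) (\<lambda>x. \<sigma> (\<tau> x) - (-1) ^ (d * e) *s \<tau> (\<sigma> x))"
  unfolding wedge_derivation_def
proof (intro conjI allI ballI)
  interpret s: Modules.additive \<sigma> using \<sigma> by (rule wedge_derivation_additive)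
  interpret t: Modules.additive \<tau> using \<tau> by (rule wedge_derivation_additive)
  show "Modules.additive (\<lambda>x. \<sigma> (\<tau> x) - (-1) ^ (d * e) *s \<tau> (\<sigma> x))"
    by unfold_locales (simp add: s.add t.add vs_simps)
  fix p and x :: "('a, 'n) ext" assume x: "x \<in> parity_part p"
  note \<sigma>x = wedge_derivation_parity[OF \<sigma> x] and \<tau>x = wedge_derivation_parity[OF \<tau> x]
  show "\<sigma> (\<tau> x) - (-1) ^ (d * e) *s \<tau> (\<sigma> x) \<in> parity_part (p + (d + e))"
    using wedge_derivation_parity[OF \<sigma> \<tau>x] wedge_derivation_parity[OF \<tau> \<sigma>x]
    by (simp add: ac_simps parity_part_linear)
  fix y
  have sgn: "\<sigma> ((-1) ^ m *s w) = (-1) ^ m *s \<sigma> w" "\<tau> ((-1) ^ m *s w) = (-1) ^ m *s \<tau> w" for m w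
    by (cases "even m"; simp add: vs_simps s.minus t.minus)+
  show "\<sigma> (\<tau> (x \<^bold>\<and> y)) - (-1) ^ (d * e) *s \<tau> (\<sigma> (x \<^bold>\<and> y)) =
      (\<sigma> (\<tau> x) - (-1) ^ (d * e) *s \<tau> (\<sigma> x)) \<^bold>\<and> y
      + (-1) ^ ((d + e) * p) *s (x \<^bold>\<and> (\<sigma> (\<tau> y) - (-1) ^ (d * e) *s \<tau> (\<sigma> y)))"
    by (cases "even p"; cases "even d"; cases "even e")
      (simp_all add: wedge_derivation_wedge[OF \<sigma> x] wedge_derivation_wedge[OF \<tau> x]
        wedge_derivation_wedge[OF \<sigma> \<tau>x] wedge_derivation_wedge[OF \<tau> \<sigma>x]
        s.add t.add sgn s.minus t.minus s.diff t.diff vs_simps wedge_linear_simps)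
qed

section \<open>Interior products with the dual basis, and maps acting on coefficients\<close>

definition contract ::
  "'n \<Rightarrow> ('a::comm_ring_1, 'n::{finite,linorder}) ext \<Rightarrow> ('a, 'n) ext" where
  "contract i w = (\<chi> J. if i \<in> J then 0 else shuffle_sign {i} J * w $ insert i J)"

lemma contract_add: "contract i (u + v) = contract i u + contract i v"
  by (simp add: contract_def vec_eq_iff algebra_simps)

lemma contract_scale: "contract i (f *s u) = f *s contract i u"
  by (simp add: contract_def vec_eq_iff algebra_simps)

interpretation contract: Modules.additive "contract i" for i by unfold_locales (rule contract_add)

lemma contract_monomial:
  "contract i (monomial I) = (if i \<in> I then shuffle_sign {i} (I - {i}) *s monomial (I - {i}) else 0)"
  by (auto simp: contract_def vec_eq_iff monomial_nth)

lemma contract_nonzero: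
  assumes "contract i u $ J \<noteq> 0"
  shows "u $ insert i J \<noteq> 0" "i \<notin> J"
  using assms by (auto simp: contract_def split: if_splits)

lemma contract_ext_power:
  assumes "u \<in> ext_power k" "contract i u $ J \<noteq> 0"
  shows "card J + 1 = k"
  using contract_nonzero[OF assms(2)] assms(1) by (fastforce simp: ext_power_def)

lemma contract_parity_part:
  assumes "u \<in> parity_part p"
  shows "contract i u \<in> parity_part (p + 1)"
  unfolding parity_part_def
proof (intro CollectI allI impI)
  fix J assume "contract i u $ J \<noteq> 0"
  from contract_nonzero[OF this] assms show "even (card J + (p + 1))"
    by (fastforce simp: parity_part_def)
qed

text \<open>The derivation rule for a first factor of degree 1; the general rule follows by
  splitting off least indices.\<close>

lemma contract_wedge_vector:
  "contract i (monomial {j} \<^bold>\<and> w) = (if i = j then w else 0) - monomial {j} \<^bold>\<and> contract i w"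
proof (induction w rule: ext_lin_induct)
  case (monomial I)
  show ?case
  proof (cases "i = j")
    case True
    then show ?thesis
      by (auto simp: wedge_monomial contract_monomial contract_scale contract.zero
          wedge_linear_simps vs_simps shuffle_sign_square' insert_absorb)
  next
    case ij: False
    show ?thesis
    proof (cases "i \<in> I \<and> j \<notin> I")
      case True
      define J where "J = I - {i}"
      have J: "I = {i} \<union> J" "i \<notin> J" "j \<notin> J" "I - {i} = J" "insert j I - {i} = {j} \<union> J"
        using True ij by (auto simp: J_def)
      \<comment> \<open>The indices \<open>i\<close> and \<open>j\<close> are distinct, so exactly
        one of their two orders is an inversion; this is the source of the minus sign.\<close>
      have s: "shuffle_sign {j} {i} = - (shuffle_sign {i} {j} :: 'a)"
        using shuffle_sign_swap[of "{j}" "{i}"] ij by simp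
      have "shuffle_sign {j} I * shuffle_sign {i} ({j} \<union> J) =
          shuffle_sign {j} {i} * shuffle_sign {j} J * (shuffle_sign {i} {j} * (shuffle_sign {i} J :: 'a))"
        unfolding J(1) using J(2,3) by (simp add: shuffle_sign_Un_right del: insert_is_Un[symmetric] Un_insert_left)
      also have "\<dots> = - (shuffle_sign {i} J * shuffle_sign {j} J)"
        by (simp add: s shuffle_sign_square' ac_simps)
      finally have "shuffle_sign {j} I * shuffle_sign {i} ({j} \<union> J) =
        - (shuffle_sign {i} J * shuffle_sign {j} J :: 'a)" .
      then show ?thesis
        using True ij J
        by (simp add: wedge_monomial contract_monomial contract_scale wedge_linear_simps vs_simps)
    next
      case False
      then show ?thesis
        using ij by (auto simp: wedge_monomial contract_monomial contract_scale contract.zero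
          wedge_linear_simps vs_simps)
    qed
  qed
qed (simp_all add: contract_add contract_scale wedge_linear_simps vs_simps)

lemma wedge_derivation_contract: "wedge_derivation 1 (contract i)"
proof (rule wedge_derivationI)
  have mon: "contract i (monomial I \<^bold>\<and> y) =
      contract i (monomial I) \<^bold>\<and> y + (-1) ^ card I *s (monomial I \<^bold>\<and> contract i y)" for I y
    using finite[of I]
  proof (induction I rule: finite_linorder_min_induct)
    case (insert j I)
    then have "j \<notin> I" by blast
    then show ?case
      by (simp add: monomial_min insert wedge_assoc contract_wedge_vector wedge_linear_simps
          vs_simps)
  qed (simp add: contract_monomial wedge_linear_simps)
  fix k and x y :: "('a, 'b) ext" assume x: "x \<in> ext_power k"
  from subsetD[OF ext_power_parity this]
  show "contract i (x \<^bold>\<and> y) = contract i x \<^bold>\<and> y + (-1) ^ (1 * k) *s (x \<^bold>\<and> contract i y)"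
  proof (induction rule: parity_induct)
    case (single f I)
    then have "(-1) ^ card I = ((-1) ^ k :: 'a)" by (intro neg_one_power_cong)
    then show ?case by (simp add: mon wedge_linear_simps contract_scale vs_simps ac_simps)
  qed (simp_all add: contract_add contract.zero wedge_linear_simps vs_simps)
  show "contract i x \<in> parity_part (k + 1)"
    using x ext_power_parity by (blast intro: contract_parity_part)
qed (rule contract.additive_axioms)

lemma contract_scalar [simp]: "contract i (ext_scalar f) = 0"
  by (simp add: ext_scalar_def contract_scale contract_monomial)

lemma contract_vector [simp]: "contract i (monomial {j}) = (if i = j then ext_scalar 1 else 0)"
  by (simp add: contract_monomial ext_scalar_def)

lemma contract_ext_vector [simp]: "contract i (ext_vector x) = ext_scalar (x $ i)"
proof -
  have "(\<Sum>j\<in>UNIV. x $ j *s (if i = j then ext_scalar 1 else 0)) =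
      (\<Sum>j\<in>UNIV. if i = j then x $ j *s ext_scalar 1 else 0)"
    by (rule sum.cong) simp_all
  then show ?thesis
    by (simp add: ext_vector_def contract.sum contract_scale ext_scalar_def vs_simps)
qed

text \<open>The index type is left open, so that vectors of E and multivectors are covered
  alike.\<close>

definition map_coeffs :: "('a \<Rightarrow> 'a) \<Rightarrow> ('a, 'n::finite) vec \<Rightarrow> ('a, 'n) vec" where
  "map_coeffs D w = (\<chi> I. D (w $ I))"

text \<open>Monomials multiply with coefficients 0, 1 and -1, through which an additive
  \<open>D\<close> passes, so the product rule for coefficients is all that is needed.\<close>

lemma wedge_derivation_map_coeffs:
  assumes D: "Modules.additive D" and mult: "\<And>f g. D (f * g) = D f * g + f * D g"
  shows "wedge_derivation 0 (map_coeffs D)"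
proof (rule wedge_derivationI)
  interpret Modules.additive D by (fact D)
  show "Modules.additive (map_coeffs D)"
    by unfold_locales (simp add: map_coeffs_def vec_eq_iff add)
  have "D (shuffle_sign I J * f) = shuffle_sign I J * D f" for I J :: "'b::{finite,linorder} set" and f
    by (cases "even (card {(i, j). i \<in> I \<and> j \<in> J \<and> j < i})") (simp_all add: shuffle_sign_def minus)
  then show "map_coeffs D (x \<^bold>\<and> y) = map_coeffs D x \<^bold>\<and> y + (-1) ^ (0 * k) *s (x \<^bold>\<and> map_coeffs D y)"
    for x y :: "('a, 'b::{finite,linorder}) ext" and k
    by (simp add: map_coeffs_def wedge_def vec_eq_iff sum mult mult.assoc distrib_left sum.distrib)
  show "map_coeffs D x \<in> parity_part (k + 0)" if "x \<in> ext_power k" for x k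
  proof -
    have "x $ I \<noteq> 0" if "D (x $ I) \<noteq> 0" for I using that zero by metis
    then show ?thesis using that by (auto simp: map_coeffs_def ext_power_def parity_part_def)
  qed
qed

section \<open>The Schouten bracket of a free Lie Rinehart algebra\<close>

lemma map_coeffs_scale_monomial:
  assumes "D 0 = 0"
  shows "map_coeffs D (f *s monomial I) = D f *s monomial I"
  using assms by (simp add: map_coeffs_def vec_eq_iff monomial_nth)

lemma ext_vector_nth: "ext_vector x $ I = (\<Sum>i\<in>UNIV. if I = {i} then x $ i else 0)"
  by (auto simp: ext_vector_def monomial_nth intro!: sum.cong)

lemma ext_vector_singleton: "ext_vector x $ {i} = x $ i"
  by (simp add: ext_vector_nth)

lemma ext_vector_add: "ext_vector (x + y) = ext_vector x + ext_vector y"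
  by (simp add: ext_vector_def vs_simps sum.distrib)

lemma ext_vector_scale: "ext_vector (f *s x) = f *s ext_vector x"
  by (simp add: ext_vector_def vs_simps sum_cmul flip: vector_smult_assoc)

interpretation ext_vector: Modules.additive ext_vector by unfold_locales (rule ext_vector_add)

lemma ext_vector_axis [simp]: "ext_vector (axis i 1) = monomial {i}"
proof -
  have "ext_vector (axis i 1) = (\<Sum>j\<in>UNIV. if j = i then monomial {i} else 0)"
    unfolding ext_vector_def by (rule sum.cong) (simp_all add: axis_def)
  then show ?thesis by simp
qed

lemma map_coeffs_ext_vector:
  assumes "Modules.additive D"
  shows "map_coeffs D (ext_vector x) = ext_vector (map_coeffs D x)"
proof -
  have "D (\<Sum>i\<in>UNIV. if I = {i} then x $ i else 0) = (\<Sum>i\<in>UNIV. if I = {i} then D (x $ i) else 0)"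
    for I
    unfolding Modules.additive.sum[OF assms]
    by (rule sum.cong) (simp_all add: Modules.additive.zero[OF assms])
  then show ?thesis unfolding map_coeffs_def vec_eq_iff ext_vector_nth vec_lambda_beta by simp
qed

lemma ext_scalar_add: "ext_scalar (f + g) = ext_scalar f + ext_scalar g"
  by (simp add: ext_scalar_def vs_simps)

lemma ext_scalar_mult: "ext_scalar (f * g) = f *s ext_scalar g"
  by (simp add: ext_scalar_def vs_simps)

interpretation ext_scalar: Modules.additive ext_scalar by unfold_locales (rule ext_scalar_add)

lemma ext_scalar_inj:
  "ext_scalar f = (ext_scalar g :: ('a::comm_ring_1, 'n::finite) ext) \<longleftrightarrow> f = g"
proof
  assume "ext_scalar f = (ext_scalar g :: ('a, 'n) ext)"
  then have "(ext_scalar f :: ('a, 'n) ext) $ {} = (ext_scalar g :: ('a, 'n) ext) $ {}" by simp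
  then show "f = g" by (simp add: ext_scalar_def monomial_nth)
qed simp

lemma ext_scalar_parity: "ext_scalar f \<in> parity_part 0"
  using ext_power_parity ext_scalar_power by blast

lemma ext_vector_parity: "ext_vector x \<in> parity_part 1"
  using ext_power_parity ext_vector_power by blast

lemma monomial_singleton_parity: "monomial {i} \<in> parity_part 1"
  by (simp add: monomial_parity_part)

text \<open>Turns the sign (-1)^p into a linear map defined on inhomogeneous elements too, so that
  the explicit bracket is additive in its first argument.\<close>

definition grade_involution :: "('a::comm_ring_1, 'n::finite) ext \<Rightarrow> ('a, 'n) ext" where
  "grade_involution w = (\<chi> I. (-1) ^ card I * w $ I)"

lemma grade_involution_parity:
  assumes "u \<in> parity_part p"
  shows "grade_involution u = (-1) ^ p *s u"
proof -
  have "(-1) ^ card I * u $ I = (-1) ^ p * u $ I" for I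
    using assms neg_one_power_cong[of "card I" p, where 'a = 'a]
    by (cases "u $ I = 0") (auto simp: parity_part_def)
  then show ?thesis by (simp add: grade_involution_def vec_eq_iff)
qed

lemma grade_involution_add: "grade_involution (u + v) = grade_involution u + grade_involution v"
  by (simp add: grade_involution_def vec_eq_iff algebra_simps)

lemma grade_involution_scale: "grade_involution (f *s u) = f *s grade_involution u"
  by (simp add: grade_involution_def vec_eq_iff algebra_simps)

locale free_lie_rinehart = lie_rinehart_algebra emb "(*s)" bracket anchor
  for emb :: "'k::field \<Rightarrow> 'a::comm_ring_1"
    and bracket :: "('a, 'n::{finite,linorder}) vec \<Rightarrow> ('a, 'n) vec \<Rightarrow> ('a, 'n) vec"
    and anchor :: "('a, 'n) vec \<Rightarrow> 'a \<Rightarrow> 'a"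
begin

section \<open>The Lie Rinehart axioms in coordinates\<close>

lemma anchor_additive: "Modules.additive (anchor x)"
proof -
  interpret Vector_Spaces.linear "\<lambda>c f. emb c * f" "\<lambda>c f. emb c * f" "anchor x"
    using anchor_derivation by (simp add: derivation_def)
  show ?thesis by unfold_locales (rule add)
qed

lemma anchor_emb: "anchor x (emb c * f) = emb c * anchor x f"
proof -
  interpret Vector_Spaces.linear "\<lambda>c f. emb c * f" "\<lambda>c f. emb c * f" "anchor x"
    using anchor_derivation by (simp add: derivation_def)
  show ?thesis by (rule scale)
qed

lemma anchor_mult: "anchor x (f * g) = anchor x f * g + f * anchor x g"
  using anchor_derivation by (auto simp: derivation_def)

lemma anchor_0_left: "anchor 0 f = 0"
  using anchor_add[of 0 0] by simp

lemma anchor_sum: "anchor (\<Sum>i\<in>S. x i) f = (\<Sum>i\<in>S. anchor (x i) f)"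
  by (induction S rule: infinite_finite_induct) (simp_all add: anchor_0_left anchor_add)

lemma anchor_expansion: "anchor x f = (\<Sum>j\<in>UNIV. x $ j * anchor (axis j 1) f)"
  using anchor_sum[of "\<lambda>j. x $ j *s axis j 1" UNIV f]
  by (simp add: anchor_scale Finite_Cartesian_Product.basis_expansion)

lemma bracket_additive: "Modules.additive (\<lambda>x. bracket x y)" "Modules.additive (\<lambda>y. bracket x y)"
proof -
  interpret L: lie_algebra "\<lambda>c. (*s) (emb c)" bracket by (rule lie_algebra)
  interpret l: Vector_Spaces.linear "\<lambda>c. (*s) (emb c)" "\<lambda>c. (*s) (emb c)" "\<lambda>x. bracket x y"
    by (rule L.bracket_linear_left)
  interpret r: Vector_Spaces.linear "\<lambda>c. (*s) (emb c)" "\<lambda>c. (*s) (emb c)" "\<lambda>y. bracket x y"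
    by (rule L.bracket_linear_right)
  show "Modules.additive (\<lambda>x. bracket x y)" "Modules.additive (\<lambda>y. bracket x y)"
    by (unfold_locales, rule l.add, unfold_locales, rule r.add)
qed

lemma bracket_skew: "bracket x y = - bracket y x"
proof -
  interpret L: lie_algebra "\<lambda>c. (*s) (emb c)" bracket by (rule lie_algebra)
  have "bracket (x + y) (x + y) = bracket x x + bracket y y + (bracket x y + bracket y x)"
    by (simp add: Modules.additive.add[OF bracket_additive(1)]
        Modules.additive.add[OF bracket_additive(2)])
  then show ?thesis by (simp add: L.bracket_self eq_neg_iff_add_eq_0)
qed

lemma bracket_jacobi: "bracket x (bracket y z) = bracket (bracket x y) z + bracket y (bracket x z)"
proof -
  interpret L: lie_algebra "\<lambda>c. (*s) (emb c)" bracket by (rule lie_algebra)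
  have "bracket x (bracket y z) = - bracket z (bracket x y) + - bracket y (bracket z x)"
    using L.jacobi[of x y z] by (simp add: algebra_simps eq_neg_iff_add_eq_0)
  also have "- bracket y (bracket z x) = bracket y (bracket x z)"
    by (subst bracket_skew[of z x]) (simp add: Modules.additive.minus[OF bracket_additive(2)])
  also have "- bracket z (bracket x y) = bracket (bracket x y) z"
    by (subst bracket_skew) simp
  finally show ?thesis .
qed

text \<open>Separates the part of [x, .] that is linear over A from the differentiation of
  coefficients; the Lie derivative of multivectors has the same two parts.\<close>

lemma bracket_expansion_right:
  "bracket x y = (\<Sum>j\<in>UNIV. y $ j *s bracket x (axis j 1)) + map_coeffs (anchor x) y"
proof -
  have "bracket x y = bracket x (\<Sum>j\<in>UNIV. y $ j *s axis j 1)"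
    by (simp add: Finite_Cartesian_Product.basis_expansion)
  also have "\<dots> = (\<Sum>j\<in>UNIV. y $ j *s bracket x (axis j 1))
      + (\<Sum>j\<in>UNIV. anchor x (y $ j) *s axis j 1)"
    by (simp add: Modules.additive.sum[OF bracket_additive(2)] leibniz sum.distrib)
  also have "(\<Sum>j\<in>UNIV. anchor x (y $ j) *s axis j 1) = map_coeffs (anchor x) y"
    using Finite_Cartesian_Product.basis_expansion[of "map_coeffs (anchor x) y"]
    by (simp add: map_coeffs_def)
  finally show ?thesis .
qed

section \<open>An explicit formula for the Schouten bracket\<close>

abbreviation coeff_deriv :: "'n \<Rightarrow> ('a, 'n) ext \<Rightarrow> ('a, 'n) ext" where
  "coeff_deriv j \<equiv> map_coeffs (anchor (axis j 1))"

text \<open>The sum over \<open>k\<close> replaces each factor e_k in turn by [e_j, e_k], so this is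
  the derivation of degree 0 that extends the anchor of e_j and the bracket with e_j.\<close>

definition lie_deriv :: "'n \<Rightarrow> ('a, 'n) ext \<Rightarrow> ('a, 'n) ext" where
  "lie_deriv j P = coeff_deriv j P
     + (\<Sum>k\<in>UNIV. ext_vector (bracket (axis j 1) (axis k 1)) \<^bold>\<and> contract k P)"

text \<open>For \<open>P\<close> of degree \<open>p\<close>, graded skew-symmetry forces \<open>[P, \<cdot>]\<close> to be the derivation with
  \<open>f \<mapsto> (-1)\<^bsup>p + 1\<^esup> \<Sum>\<^sub>j \<theta>(e\<^sub>j)(f) \<iota>\<^sub>j P\<close> and \<open>e\<^sub>j \<mapsto> - [e\<^sub>j, P]\<close>, where \<open>[e\<^sub>j, \<cdot>]\<close> is \<open>lie_deriv j\<close>.\<close>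

definition br :: "('a, 'n) ext \<Rightarrow> ('a, 'n) ext \<Rightarrow> ('a, 'n) ext" where
  "br P Q = - (\<Sum>j\<in>UNIV. contract j (grade_involution P) \<^bold>\<and> coeff_deriv j Q
                      + lie_deriv j P \<^bold>\<and> contract j Q)"

lemma wedge_derivation_coeff_deriv: "wedge_derivation 0 (coeff_deriv j)"
  by (intro wedge_derivation_map_coeffs anchor_additive anchor_mult)

lemma wedge_derivation_lie_deriv: "wedge_derivation 0 (lie_deriv j)"
proof -
  have "wedge_derivation (1 + 1) (\<lambda>P. ext_vector (bracket (axis j 1) (axis k 1)) \<^bold>\<and> contract k P)" for k
    by (intro wedge_derivation_left_wedge ext_vector_parity wedge_derivation_contract)
  from wedge_derivation_cong[OF _ this, of 0] show ?thesis
    unfolding lie_deriv_def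
    by (intro wedge_derivation_add wedge_derivation_coeff_deriv wedge_derivation_sum) simp
qed

lemma wedge_derivation_br:
  assumes "P \<in> parity_part p"
  shows "wedge_derivation (p + 1) (br P)"
proof -
  have "wedge_derivation (p + 1 + 0) (\<lambda>Q. contract j (grade_involution P) \<^bold>\<and> coeff_deriv j Q)" for j
    using assms
    by (intro wedge_derivation_left_wedge wedge_derivation_coeff_deriv contract_parity_part)
      (simp add: grade_involution_parity parity_part_linear)
  moreover have "wedge_derivation (p + 1) (\<lambda>Q. lie_deriv j P \<^bold>\<and> contract j Q)" for j
    using wedge_derivation_parity[OF wedge_derivation_lie_deriv assms]
    by (intro wedge_derivation_left_wedge wedge_derivation_contract) simp
  ultimately show ?thesis
    unfolding br_def
    by (intro wedge_derivation_uminus wedge_derivation_sum wedge_derivation_add) simp_all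
qed

interpretation coeff_deriv: Modules.additive "coeff_deriv j" for j
  by (rule wedge_derivation_additive[OF wedge_derivation_coeff_deriv])

interpretation lie_deriv: Modules.additive "lie_deriv j" for j
  by (rule wedge_derivation_additive[OF wedge_derivation_lie_deriv])

lemma br_add_left: "br (P + Q) R = br P R + br Q R"
  by (simp add: br_def grade_involution_add contract_add wedge_linear_simps lie_deriv.add
      sum.distrib)

lemma br_add_right: "br R (P + Q) = br R P + br R Q"
  by (simp add: br_def contract_add wedge_linear_simps coeff_deriv.add sum.distrib)

interpretation br_left: Modules.additive "\<lambda>P. br P Q" for Q by unfold_locales (rule br_add_left)
interpretation br_right: Modules.additive "\<lambda>Q. br P Q" for P by unfold_locales (rule br_add_right)

lemmas br_additive_left = br_left.additive_axioms and br_additive_right = br_right.additive_axioms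
lemmas br_zero = br_left.zero br_right.zero
lemmas br_minus = br_left.minus br_right.minus
lemmas br_diff = br_left.diff br_right.diff

lemma coeff_deriv_emb: "coeff_deriv j (emb c *s P) = emb c *s coeff_deriv j P"
  by (simp add: map_coeffs_def vec_eq_iff anchor_emb)

lemma lie_deriv_emb: "lie_deriv j (emb c *s P) = emb c *s lie_deriv j P"
  by (simp add: lie_deriv_def coeff_deriv_emb contract_scale wedge_linear_simps vs_simps sum_cmul)

lemma br_emb_left: "br (emb c *s P) Q = emb c *s br P Q"
  by (simp add: br_def lie_deriv_emb contract_scale grade_involution_scale wedge_linear_simps
      vs_simps sum_cmul flip: vector_add_ldistrib)

lemma br_emb_right: "br Q (emb c *s P) = emb c *s br Q P"
  by (simp add: br_def coeff_deriv_emb contract_scale wedge_linear_simps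
      vs_simps sum_cmul flip: vector_add_ldistrib)

text \<open>The bracket splits into two sums of first-order terms and a sum \<open>M\<close> over
  the brackets of basis vectors. Exchanging the arguments swaps the two first-order sums
  (\<open>c1\<close>, \<open>c2\<close>), whereas \<open>M\<close> is mapped to itself up to sign by
  renaming \<open>j\<close> and \<open>k\<close> and using the skew-symmetry of
  \<open>B\<close>.\<close>

lemma br_skew:
  assumes P: "P \<in> parity_part p" and Q: "Q \<in> parity_part q"
  shows "br P Q = - ((-1) ^ ((p + 1) * (q + 1)) *s br Q P)"
proof -
  define s :: 'a where "s = (-1) ^ ((p + 1) * (q + 1))"
  define B where "B j k = ext_vector (bracket (axis j 1) (axis k 1))" for j k
  have B: "B j k = - B k j" for j k
    unfolding B_def by (subst bracket_skew) (rule ext_vector.minus)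
  define M where "M P Q = (\<Sum>j\<in>UNIV. \<Sum>k\<in>UNIV. B j k \<^bold>\<and> contract k P \<^bold>\<and> contract j Q)" for P Q
  have expand: "br P Q = - (\<Sum>j\<in>UNIV. (-1) ^ p *s (contract j P \<^bold>\<and> coeff_deriv j Q)
        + coeff_deriv j P \<^bold>\<and> contract j Q) - M P Q" if "P \<in> parity_part p" for P Q p
    by (simp add: br_def lie_deriv_def M_def B_def grade_involution_parity[OF that] contract_scale
        wedge_linear_simps wedge_left.sum sum.distrib)
  note par = contract_parity_part[OF P] contract_parity_part[OF Q]
    wedge_derivation_parity[OF wedge_derivation_coeff_deriv P]
    wedge_derivation_parity[OF wedge_derivation_coeff_deriv Q]
  have "B j k \<^bold>\<and> contract k Q \<^bold>\<and> contract j P = s *s (B j k \<^bold>\<and> contract j P \<^bold>\<and> contract k Q)" for j k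
    unfolding wedge_assoc
    by (subst wedge_commute[OF par(2) par(1)]) (simp add: wedge_linear_simps s_def mult.commute)
  then have "M Q P = s *s (\<Sum>j\<in>UNIV. \<Sum>k\<in>UNIV. B j k \<^bold>\<and> contract j P \<^bold>\<and> contract k Q)"
    by (simp add: M_def sum_cmul)
  also have "(\<Sum>j\<in>UNIV. \<Sum>k\<in>UNIV. B j k \<^bold>\<and> contract j P \<^bold>\<and> contract k Q) =
      (\<Sum>j\<in>UNIV. \<Sum>k\<in>UNIV. B k j \<^bold>\<and> contract k P \<^bold>\<and> contract j Q)"
    by (rule sum.swap)
  also have "\<dots> = - M P Q"
    unfolding M_def sum_negf[symmetric] by (subst B) (simp add: wedge_linear_simps)
  finally have M: "M Q P = - (s *s M P Q)" by (simp add: vs_simps)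
  have ss: "s * s = 1" by (simp add: s_def flip: power_mult_distrib)
  have c1: "(-1) ^ p *s (contract j P \<^bold>\<and> coeff_deriv j Q) = - (s *s (coeff_deriv j Q \<^bold>\<and> contract j P))"
    for j
    by (subst wedge_commute[OF par(1) par(4)], cases "even p"; cases "even q")
      (simp_all add: s_def vs_simps)
  have c2: "(-1) ^ q *s (contract j Q \<^bold>\<and> coeff_deriv j P) = - (s *s (coeff_deriv j P \<^bold>\<and> contract j Q))"
    for j
    by (subst wedge_commute[OF par(2) par(3)], cases "even p"; cases "even q")
      (simp_all add: s_def vs_simps)
  show ?thesis
    unfolding expand[OF P] expand[OF Q] M c1 c2 s_def[symmetric]
    by (simp add: vs_simps ss sum_subtractf sum_cmul)
qed

lemma br_scalar_scalar [simp]: "br (ext_scalar f) (ext_scalar g) = 0"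
  by (simp add: br_def grade_involution_parity[OF ext_scalar_parity] wedge_linear_simps)

lemma coeff_deriv_scalar: "coeff_deriv j (ext_scalar f) = ext_scalar (anchor (axis j 1) f)"
  unfolding ext_scalar_def
  by (rule map_coeffs_scale_monomial) (rule Modules.additive.zero[OF anchor_additive])

lemma br_right_scalar:
  "br P (ext_scalar f) = - (\<Sum>j\<in>UNIV. anchor (axis j 1) f *s contract j (grade_involution P))"
  by (simp add: br_def coeff_deriv_scalar wedge_linear_simps)

lemma br_vector_scalar: "br (ext_vector x) (ext_scalar f) = ext_scalar (anchor x f)"
  unfolding br_right_scalar
  by (simp add: grade_involution_parity[OF ext_vector_parity] contract_scale contract.minus
      vs_simps sum_negf anchor_expansion[of x f] ext_scalar.sum mult.commute
      flip: ext_scalar_mult)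

lemma br_scalar_vector: "br (ext_scalar f) (ext_vector x) = - ext_scalar (anchor x f)"
  by (subst br_skew[OF ext_scalar_parity ext_vector_parity])
    (simp add: br_vector_scalar)

lemma lie_deriv_vector: "lie_deriv j (ext_vector x) = ext_vector (bracket (axis j 1) x)"
  by (simp add: lie_deriv_def map_coeffs_ext_vector[OF anchor_additive] ext_vector.sum
      bracket_expansion_right[of "axis j 1" x] ext_vector_add ext_vector_scale add.commute)

lemma br_vector_vector: "br (ext_vector x) (ext_vector y) = ext_vector (bracket x y)"
proof -
  have "map_coeffs (anchor x) y = (\<Sum>j\<in>UNIV. x $ j *s map_coeffs (anchor (axis j 1)) y)"
    by (simp add: map_coeffs_def vec_eq_iff anchor_expansion[of x])
  \<comment> \<open>\<open>br\<close> takes Lie derivatives of its first argument along the basis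
    vectors, so [x, e_j] has to be rewritten as - [e_j, x].\<close>
  then have "bracket x y = (\<Sum>j\<in>UNIV. x $ j *s map_coeffs (anchor (axis j 1)) y)
      - (\<Sum>j\<in>UNIV. y $ j *s bracket (axis j 1) x)"
    unfolding bracket_expansion_right[of x y]
    by (subst bracket_skew) (simp add: vs_simps sum_negf)
  then show ?thesis
    by (simp add: br_def grade_involution_parity[OF ext_vector_parity] contract.minus vs_simps
        lie_deriv_vector map_coeffs_ext_vector[OF anchor_additive] wedge_linear_simps
        ext_vector.diff ext_vector.sum ext_vector_scale sum_subtractf sum.distrib sum_negf)
qed

section \<open>The graded Jacobi identity\<close>

text \<open>It suffices to test on generators: for fixed \<open>x\<close> the defect of the identity is a derivation in \<open>y\<close>,
  and it is graded skew-symmetric in \<open>x\<close> and \<open>y\<close>.\<close>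

lemma bracket_derivation_generators:
  assumes \<sigma>: "wedge_derivation d \<sigma>"
    and ff: "\<And>f g. br (\<sigma> (ext_scalar f)) (ext_scalar g)
      + (-1) ^ d *s br (ext_scalar f) (\<sigma> (ext_scalar g)) = 0"
    and vf: "\<And>i f. \<sigma> (br (monomial {i}) (ext_scalar f)) =
      br (\<sigma> (monomial {i})) (ext_scalar f) + br (monomial {i}) (\<sigma> (ext_scalar f))"
    and vv: "\<And>i j. \<sigma> (br (monomial {i}) (monomial {j})) =
      br (\<sigma> (monomial {i})) (monomial {j}) + br (monomial {i}) (\<sigma> (monomial {j}))"
    and x: "x \<in> parity_part p"
  shows "\<sigma> (br x y) = br (\<sigma> x) y + (-1) ^ (d * (p + 1)) *s br x (\<sigma> y)"
proof -
  interpret Modules.additive \<sigma> using \<sigma> by (rule wedge_derivation_additive)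
  \<comment> \<open>The first two terms form the graded commutator of \<open>\<sigma>\<close> and
    [x, .]; this makes the defect a derivation in \<open>y\<close>.\<close>
  define T where "T p x y = \<sigma> (br x y) - (-1) ^ (d * (p + 1)) *s br x (\<sigma> y) - br (\<sigma> x) y"
    for p x y
  have deriv: "wedge_derivation (d + (p + 1)) (T p x)" if x: "x \<in> parity_part p" for p x
  proof -
    have "wedge_derivation (d + (p + 1)) (br (\<sigma> x))"
      using wedge_derivation_br[OF wedge_derivation_parity[OF \<sigma> x]] by (simp add: ac_simps)
    then show ?thesis
      unfolding T_def
      by (intro wedge_derivation_diff wedge_derivation_commutator \<sigma> wedge_derivation_br x)
  qed
  have skew: "T p x y = - ((-1) ^ ((p + 1) * (q + 1)) *s T q y x)"
    if x: "x \<in> parity_part p" and y: "y \<in> parity_part q" for p q x y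
    unfolding T_def br_skew[OF x y] br_skew[OF wedge_derivation_parity[OF \<sigma> x] y]
      br_skew[OF x wedge_derivation_parity[OF \<sigma> y]]
    by (cases "even p"; cases "even q"; cases "even d") (simp_all add: vs_simps minus)
  have Tff: "T 0 (ext_scalar f) (ext_scalar g) = 0" for f g
    using ff[of f g] zero by (simp add: T_def algebra_simps add_eq_0_iff2)
  have Tvf: "T 1 (monomial {i}) (ext_scalar f) = 0" for i f
    using vf[of i f] by (simp add: T_def)
  have Tfv: "T 0 (ext_scalar f) (monomial {i}) = 0" for i f
    using skew[OF ext_scalar_parity monomial_singleton_parity] Tvf by simp
  have Tvv: "T 1 (monomial {i}) (monomial {j}) = 0" for i j
    using vv[of i j] by (simp add: T_def)
  have Tf: "T 0 (ext_scalar f) y = 0" for f y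
    by (rule wedge_derivation_eq_0[OF deriv[OF ext_scalar_parity]]) (simp_all add: Tff Tfv)
  have Tv: "T 1 (monomial {i}) y = 0" for i y
    by (rule wedge_derivation_eq_0[OF deriv[OF monomial_singleton_parity]]) (simp_all only: Tvf Tvv)
  have "T p x y = 0"
    by (rule wedge_derivation_eq_0[OF deriv[OF x]])
      (simp_all add: Tf Tv skew[OF x ext_scalar_parity] skew[OF x monomial_singleton_parity]
        del: One_nat_def)
  then show ?thesis by (simp add: T_def algebra_simps)
qed

text \<open>With a generator outermost and generators in the other slots, the identity is trivial,
  or says that the anchor respects brackets, or is the Jacobi identity of E. The factors 1 and 2 in
  the exponents are the values of \<open>d\<close> for brackets with functions and with
  vectors.\<close>

lemma jacobi_generators:
  assumes x: "x \<in> parity_part p"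
  shows "br (ext_scalar f) (br x y) = br (br (ext_scalar f) x) y
      + (-1) ^ (1 * (p + 1)) *s br x (br (ext_scalar f) y)" (is ?scalar)
    and "br (ext_vector v) (br x y) = br (br (ext_vector v) x) y
      + (-1) ^ (2 * (p + 1)) *s br x (br (ext_vector v) y)" (is ?vector)
proof -
  note v = ext_vector_axis[symmetric]
  show ?scalar
    by (rule bracket_derivation_generators[OF _ _ _ _ x])
      (use wedge_derivation_br[OF ext_scalar_parity] in
        \<open>simp_all add: br_zero br_vector_scalar br_scalar_vector br_vector_vector br_minus
          anchor_bracket ext_scalar.diff v del: ext_vector_axis\<close>)
  show ?vector
    by (rule bracket_derivation_generators[OF _ _ _ _ x])
      (use wedge_derivation_br[OF ext_vector_parity] in
        \<open>simp_all add: br_zero br_vector_scalar br_scalar_vector br_vector_vector br_minus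
          anchor_bracket ext_scalar.diff v bracket_jacobi[of v] ext_vector_add numeral_2_eq_2
          del: ext_vector_axis\<close>)
qed

text \<open>The second round of testing on generators, now for the derivation [x, .] with arbitrary
  \<open>x\<close>. The cases it requires have a generator in the middle slot, and graded
  skew-symmetry brings that generator to the outermost slot treated before.\<close>

lemma br_jacobi:
  assumes x: "x \<in> parity_part p" and y: "y \<in> parity_part q"
  shows "br x (br y z) = br (br x y) z + (-1) ^ ((p + 1) * (q + 1)) *s br y (br x z)"
proof -
  have f: "br x (br (ext_scalar f) z) =
      br (br x (ext_scalar f)) z + (-1) ^ (p + 1) *s br (ext_scalar f) (br x z)" for f z
    using jacobi_generators(1)[OF x, of f z]
    by (cases "even p") (simp_all add: br_skew[OF ext_scalar_parity x] br_minus vs_simps)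
  have v: "br x (br (monomial {i}) z) =
      br (br x (monomial {i})) z + br (monomial {i}) (br x z)" for i z
    using jacobi_generators(2)[OF x, of "axis i 1" z]
    by (cases "even p") (simp_all add: br_skew[OF monomial_singleton_parity x] br_minus vs_simps)
  show ?thesis
  proof (rule bracket_derivation_generators[OF wedge_derivation_br[OF x] _ v v y])
    show "br (br x (ext_scalar f)) (ext_scalar g)
        + (-1) ^ (p + 1) *s br (ext_scalar f) (br x (ext_scalar g)) = 0" for f g
      using f[of f "ext_scalar g"] by (simp add: br_zero)
  qed
qed

text \<open>The parity calculus sees degrees only modulo 2, so the exact degree is read off the
  supports: each summand contains one contraction, which lowers the degree by 1, and all other
  operators preserve it.\<close>

lemma br_degree:
  assumes x: "x \<in> ext_power k" and y: "y \<in> ext_power l" and nz: "br x y $ I \<noteq> 0"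
  shows "card I + 1 = k + l"
proof -
  have zero: "anchor v 0 = 0" for v by (rule Modules.additive.zero[OF anchor_additive])
  have 1: "grade_involution x \<in> ext_power k" using x by (force simp: ext_power_def grade_involution_def)
  have 2: "coeff_deriv j w \<in> ext_power m" if "w \<in> ext_power m" for j w m
    using that zero unfolding ext_power_def map_coeffs_def by force
  have 3: "(ext_vector v \<^bold>\<and> contract j w) \<in> ext_power m" if "w \<in> ext_power m" for v j w m
    unfolding ext_power_def
  proof (intro CollectI allI impI)
    fix K assume "(ext_vector v \<^bold>\<and> contract j w) $ K \<noteq> 0"
    then obtain I J where "ext_vector v $ I \<noteq> 0" "contract j w $ J \<noteq> 0" "I \<inter> J = {}" "K = I \<union> J"
      by (rule wedge_nonzero)
    with contract_ext_power[OF that] ext_vector_power[of v] show "card K = m"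
      by (fastforce simp: card_Un_disjoint ext_power_def)
  qed
  have 4: "lie_deriv j x \<in> ext_power k" for j
    unfolding lie_deriv_def using x by (intro ext_power_linear ext_power_sum 2 3)
  obtain j where "(contract j (grade_involution x) \<^bold>\<and> coeff_deriv j y) $ I \<noteq> 0
      \<or> (lie_deriv j x \<^bold>\<and> contract j y) $ I \<noteq> 0"
    using nz by (auto simp: br_def elim!: sum.not_neutral_contains_not_neutral) (metis add.left_neutral)
  then show ?thesis
  proof
    assume "(contract j (grade_involution x) \<^bold>\<and> coeff_deriv j y) $ I \<noteq> 0"
    then show ?thesis
      by (rule wedge_nonzero)
        (use contract_ext_power[OF 1] 2[OF y, of j] in \<open>fastforce simp: card_Un_disjoint ext_power_def\<close>)
  next
    assume "(lie_deriv j x \<^bold>\<and> contract j y) $ I \<noteq> 0"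
    then show ?thesis
      by (rule wedge_nonzero)
        (use contract_ext_power[OF y] 4[of j] in \<open>fastforce simp: card_Un_disjoint ext_power_def\<close>)
  qed
qed

section \<open>The Schouten axioms and uniqueness\<close>

lemma vector_space_emb: "vector_space (\<lambda>c. (*s) (emb c) :: ('a, 'm::finite) vec \<Rightarrow> _)"
  using algebra by unfold_locales (auto simp: algebra_map_def vs_simps)

lemma ext_linear_iff: "ext_linear emb \<sigma> \<longleftrightarrow>
    Modules.additive \<sigma> \<and> (\<forall>c w. \<sigma> (emb c *s w) = emb c *s (\<sigma> w :: ('a, 'n) ext))"
  unfolding ext_linear_def Vector_Spaces.linear_iff Modules.additive_def
  using vector_space_emb[where 'm = "'n set"] by auto

lemma is_schouten_br: "is_schouten emb bracket anchor br"
  unfolding is_schouten_def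
proof (intro conjI allI ballI impI)
  show "ext_linear emb (br x)" "ext_linear emb (\<lambda>x. br x y)" for x y
    by (simp_all add: ext_linear_iff br_additive_left br_additive_right br_emb_left br_emb_right)
  fix k l and x y :: "('a, 'n) ext" assume x: "x \<in> ext_power k" and y: "y \<in> ext_power l"
  show "card I + 1 = k + l" if "br x y $ I \<noteq> 0" for I using br_degree[OF x y that] .
  note xy = subsetD[OF ext_power_parity x] subsetD[OF ext_power_parity y]
  show "br x y = - ((-1) ^ ((k + 1) * (l + 1)) *s br y x)" by (rule br_skew[OF xy])
  show "br x (br y z) = br (br x y) z + (-1) ^ ((k + 1) * (l + 1)) *s br y (br x z)" for z
    by (rule br_jacobi[OF xy])
  show "br x (y \<^bold>\<and> z) = br x y \<^bold>\<and> z + (-1) ^ ((k + 1) * l) *s (y \<^bold>\<and> br x z)" for z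
    using wedge_derivation_wedge[OF wedge_derivation_br[OF xy(1)] xy(2)] .
qed (simp_all add: br_vector_vector br_vector_scalar)

text \<open>The Leibniz rule makes \<open>S x\<close> a derivation, determined by functions and
  vectors. Agreement is shown first for \<open>x\<close> a function or a vector; skew-symmetry then
  gives the values of \<open>S x\<close> on generators for homogeneous \<open>x\<close>, and
  additivity covers the rest.\<close>

lemma schouten_unique:
  assumes S: "is_schouten emb bracket anchor S"
  shows "S = br"
proof -
  have lin: "ext_linear emb (S x)" "ext_linear emb (\<lambda>x. S x y)" for x y
    using S by (simp_all add: is_schouten_def)
  have add: "Modules.additive (S x)" "Modules.additive (\<lambda>x. S x y)" for x y
    using lin by (auto simp: ext_linear_iff)
  note axioms = S[unfolded is_schouten_def, THEN conjunct2, THEN conjunct2]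
  have deg: "card I + 1 = k + l" if "x \<in> ext_power k" "y \<in> ext_power l" "S x y $ I \<noteq> 0" for k l x y I
    using axioms[THEN conjunct1] that by blast
  have skew: "S x y = - ((-1) ^ ((k + 1) * (l + 1)) *s S y x)"
    if "x \<in> ext_power k" "y \<in> ext_power l" for k l x y
    using axioms[THEN conjunct2, THEN conjunct1] that by blast
  have vv: "S (ext_vector x) (ext_vector y) = ext_vector (bracket x y)"
    and vf: "S (ext_vector x) (ext_scalar f) = ext_scalar (anchor x f)" for x y f
    using S by (simp_all add: is_schouten_def)
  have leib: "S x (y \<^bold>\<and> z) = S x y \<^bold>\<and> z + (-1) ^ ((k + 1) * l) *s (y \<^bold>\<and> S x z)"
    if "x \<in> ext_power k" "y \<in> ext_power l" for k l x y z
    using axioms[THEN conjunct2, THEN conjunct2, THEN conjunct2, THEN conjunct2, THEN conjunct2] that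
    by blast
  have deriv: "wedge_derivation (k + 1) (S x)" if "x \<in> ext_power k" for k x
  proof (rule wedge_derivationI[OF add(1) _ leib[OF that]])
    fix l and y :: "('a, 'n) ext" assume "y \<in> ext_power l"
    note deg = deg[OF that this]
    show "S x y \<in> parity_part (l + (k + 1))"
      unfolding parity_part_def
    proof (intro CollectI allI impI)
      fix I assume "S x y $ I \<noteq> 0"
      from deg[OF this] show "even (card I + (l + (k + 1)))" by presburger
    qed
  qed
  have diff: "wedge_derivation (k + 1) (\<lambda>y. S x y - br x y)" if "x \<in> ext_power k" for k x
    using that ext_power_parity by (intro wedge_derivation_diff deriv wedge_derivation_br) blast+
  \<comment> \<open>The degree condition reads \<open>card I + 1 = 0 + 0\<close>, which no index set
    satisfies.\<close>
  have ff: "S (ext_scalar f) (ext_scalar g) = 0" for f g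
    using deg[OF ext_scalar_power[of f] ext_scalar_power[of g]] by (auto simp: vec_eq_iff)
  have fv: "S (ext_scalar f) (ext_vector x) = br (ext_scalar f) (ext_vector x)" for f x
    by (subst skew[OF ext_scalar_power ext_vector_power]) (simp add: vf br_scalar_vector)
  note v = ext_vector_axis[symmetric]
  have f: "S (ext_scalar f) y = br (ext_scalar f) y" for f y
    using wedge_derivation_eq_0[OF diff[OF ext_scalar_power], of f y]
    by (simp add: ff fv v del: ext_vector_axis)
  have x: "S (ext_vector x) y = br (ext_vector x) y" for x y
    using wedge_derivation_eq_0[OF diff[OF ext_vector_power], of x y]
    by (simp add: vf vv v br_vector_scalar br_vector_vector del: ext_vector_axis)
  have hom: "S x y = br x y" if "x \<in> ext_power k" for k x y
  proof -
    note par = subsetD[OF ext_power_parity that]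
    have "S x (ext_scalar f) = br x (ext_scalar f)" for f
      by (subst skew[OF that ext_scalar_power], subst br_skew[OF par ext_scalar_parity]) (simp add: f)
    moreover have "S x (monomial {i}) = br x (monomial {i})" for i
      unfolding v
      by (subst skew[OF that ext_vector_power], subst br_skew[OF par ext_vector_parity]) (simp only: x)
    ultimately show ?thesis
      using wedge_derivation_eq_0[OF diff[OF that], of y] by simp
  qed
  show ?thesis
  proof (intro ext)
    fix x y
    have "S (x $ I *s monomial I) y = br (x $ I *s monomial I) y" for I
      by (rule hom[of _ "card I"]) (simp add: ext_power_linear monomial_ext_power)
    then show "S x y = br x y"
      using additive_expansion[OF add(2), of x y] additive_expansion[OF br_additive_left, of x y]
      by simp
  qed
qed

lemma schouten_eq_br: "schouten emb bracket anchor = br"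
  unfolding schouten_def
  using is_schouten_br schouten_unique by (rule the_equality)

end

section \<open>The crossed product\<close>

lemma rat_deriv_add: "rat_deriv (f + g) = rat_deriv f + rat_deriv g"
proof (cases f)
  case f: (Fract p q)
  show ?thesis
  proof (cases g)
    case (Fract r s)
    then show ?thesis
      using f by (simp add: rat_deriv_Fract eq_fract pderiv_mult pderiv_add algebra_simps)
  qed
qed

lemma rat_deriv_mult: "rat_deriv (f * g) = rat_deriv f * g + f * rat_deriv g"
proof (cases f)
  case f: (Fract p q)
  show ?thesis
  proof (cases g)
    case (Fract r s)
    then show ?thesis
      using f by (simp add: rat_deriv_Fract eq_fract pderiv_mult algebra_simps)
  qed
qed

lemma rat_deriv_to_rat: "rat_deriv (to_rat p) = to_rat (pderiv p)"
  by (simp add: to_rat_def rat_deriv_Fract)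

lemma rat_deriv_const: "rat_deriv (const_rat c) = 0"
  by (simp add: const_rat_def rat_deriv_to_rat to_rat_0 pderiv_pCons)

lemma const_rat_1: "const_rat 1 = 1"
  by (simp add: const_rat_def to_rat_def One_fract_def flip: one_pCons)

lemma const_rat_0: "const_rat 0 = 0"
  by (simp add: const_rat_def to_rat_0)

lemma rat_deriv_1: "rat_deriv 1 = 0"
  using rat_deriv_const[of 1] by (simp add: const_rat_1)

interpretation rat_deriv: Modules.additive rat_deriv by unfold_locales (rule rat_deriv_add)

lemma algebra_map_const_rat: "algebra_map const_rat"
  by (simp add: algebra_map_def const_rat_1 const_rat_add const_rat_mult)

interpretation const_rat_vs: vector_space "\<lambda>c w. const_rat c *s w"
  by unfold_locales (simp_all add: vs_simps const_rat_1 const_rat_add const_rat_mult)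

lemma half_double:
  fixes x :: "('k::field_char_0 poly fract, 'm::finite) vec"
  shows "const_rat (1 / 2) *s (x + x) = x"
proof -
  have "const_rat (1 / 2) *s (x + x) = const_rat (1 / 2 + 1 / 2) *s x"
    by (simp only: const_rat_add vs_simps)
  then show ?thesis by (simp add: const_rat_1)
qed

lemma double_eq_0:
  fixes x :: "('k::field_char_0 poly fract, 'm::finite) vec"
  assumes "x + x = 0"
  shows "x = 0"
  using half_double[of x] assms by simp

text \<open>The factor 1/2 of the compatibility condition is taken in K(t). Seen as a constant, it
  passes through the bracket, which is bilinear over K only.\<close>

lemma rat_half: "(1 / 2 :: 'k::field_char_0 poly fract) = const_rat (1 / 2)"
proof -
  have "const_rat (1 / 2) + const_rat (1 / 2) = (1 :: 'k poly fract)"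
    by (simp add: const_rat_1 flip: const_rat_add)
  moreover from this have "(2 :: 'k poly fract) \<noteq> 0"
    by (metis mult_2 mult_zero_left zero_neq_one)
  ultimately show ?thesis by (simp add: field_simps)
qed

text \<open>On polynomials the product rule determines \<open>\<delta>\<close> by induction along
  Horner's scheme; the product rule for f q = p extends this to fractions.\<close>

lemma rat_derivation_unique:
  fixes \<delta> :: "'k::field poly fract \<Rightarrow> ('k poly fract, 'm::finite) vec"
  assumes "Modules.additive \<delta>"
    and mult: "\<And>f g. \<delta> (f * g) = g *s \<delta> f + f *s \<delta> g"
    and const: "\<And>c. \<delta> (const_rat c) = 0"
  shows "\<delta> f = rat_deriv f *s \<delta> (to_rat [:0, 1:])"
proof -
  interpret Modules.additive \<delta> by fact
  let ?v = "\<delta> (to_rat [:0, 1:])"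
  have poly: "\<delta> (to_rat p) = to_rat (pderiv p) *s ?v" for p
  proof (induction p)
    case (pCons a p)
    have "pCons a p = [:a:] + [:0, 1:] * p" by simp
    then have "to_rat (pCons a p) = const_rat a + to_rat [:0, 1:] * to_rat p"
      by (simp only: to_rat_add to_rat_mult const_rat_def)
    moreover have "pderiv (pCons a p) = p + [:0, 1:] * pderiv p" by (simp add: pderiv_pCons)
    then have "to_rat (pderiv (pCons a p)) = to_rat p + to_rat [:0, 1:] * to_rat (pderiv p)"
      by (simp only: to_rat_add to_rat_mult)
    ultimately show ?case
      by (simp only: add mult const pCons.IH) (simp add: vs_simps)
  qed (use zero in \<open>simp add: to_rat_0\<close>)
  show ?thesis
  proof (cases f)
    case (Fract p q)
    then have q: "to_rat q \<noteq> 0" by (simp add: to_rat_def Zero_fract_def eq_fract)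
    have f: "f * to_rat q = to_rat p" using Fract by (simp add: to_rat_def eq_fract)
    have "to_rat q *s \<delta> f = to_rat (pderiv p) *s ?v - f *s (to_rat (pderiv q) *s ?v)"
      using mult[of f "to_rat q"] by (simp add: f poly[of p] poly[of q])
    also have "\<dots> = (rat_deriv (f * to_rat q) - f * rat_deriv (to_rat q)) *s ?v"
      unfolding f by (simp add: rat_deriv_to_rat vs_simps)
    also have "\<dots> = to_rat q *s (rat_deriv f *s ?v)"
      by (simp add: rat_deriv_mult vs_simps mult.commute)
    finally show ?thesis using q vector_mul_lcancel by blast
  qed
qed

section \<open>The crossed product as a Lie Rinehart algebra\<close>

locale crossed_product = lie_algebra smul bracket
  for smul :: "'k::field_char_0 \<Rightarrow> 'g::ab_group_add \<Rightarrow> 'g" and bracket +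
  fixes b :: "'n::{finite,linorder} \<Rightarrow> 'g" and \<theta> :: "'g \<Rightarrow> 'k poly"
  assumes basis: "basis_family smul b" and action: "poly_action smul bracket \<theta>"
begin

abbreviation cbracket where "cbracket \<equiv> crossed_bracket smul bracket b \<theta>"
abbreviation ctheta where "ctheta \<equiv> crossed_theta b \<theta>"
abbreviation canchor where "canchor \<equiv> crossed_anchor b \<theta>"
abbreviation tens where "tens \<equiv> tensor smul b"
abbreviation th where "th i \<equiv> to_rat (\<theta> (b i))"

lemmas tens_add_right = tensor_add_right[OF lie_algebra_axioms basis action]
lemmas tens_scale_right = tensor_scale_right[OF lie_algebra_axioms basis action]
lemmas ctheta_tens = crossed_theta_tensor[OF lie_algebra_axioms basis action]
lemmas cbracket_tens = crossed_bracket_tensor[OF lie_algebra_axioms basis action]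

sublocale tens_right: Modules.additive "tens f" for f
  by unfold_locales (rule tens_add_right)

lemma tens_scale_left: "tens (f * g) X = f *s tens g X"
  by (simp add: tensor_def vec_eq_iff mult.assoc)

lemma tens_scale_left': "tens f X = f *s tens 1 X"
  using tens_scale_left[of f 1 X] by simp

lemma tens_basis: "tens f (b i) = f *s axis i 1"
proof -
  note facts = basis_facts[OF lie_algebra_axioms basis action]
  have "representation (range b) (b i) (b j) = (if j = i then 1 else 0)" for j
    using facts by (simp add: representation_basis inj_eq)
  then show ?thesis by (simp add: tensor_def vec_eq_iff axis_def const_rat_1 const_rat_0)
qed

lemma bracket_minus_swap: "bracket X Y = - bracket Y X"
proof -
  interpret l: Vector_Spaces.linear smul smul "\<lambda>x. bracket x w" for w
    by (fact bracket_linear_left)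
  interpret r: Vector_Spaces.linear smul smul "\<lambda>y. bracket w y" for w
    by (fact bracket_linear_right)
  have "bracket (X + Y) (X + Y) = bracket X X + bracket Y Y + (bracket X Y + bracket Y X)"
    by (simp only: l.add r.add) (simp add: algebra_simps)
  then show ?thesis by (simp add: bracket_self eq_neg_iff_add_eq_0)
qed

lemma cbracket_add_left: "cbracket (u + v) w = cbracket u w + cbracket v w"
  by (simp add: crossed_bracket_def tensor_add_left rat_deriv_add distrib_left distrib_right
      sum.distrib sum_subtractf)

lemma cbracket_add_right: "cbracket w (u + v) = cbracket w u + cbracket w v"
  by (simp add: crossed_bracket_def tensor_add_left rat_deriv_add distrib_left distrib_right
      sum.distrib sum_subtractf)

sublocale cbracket_left: Modules.additive "\<lambda>u. cbracket u v" for v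
  by unfold_locales (rule cbracket_add_left)

sublocale cbracket_right: Modules.additive "\<lambda>u. cbracket v u" for v
  by unfold_locales (rule cbracket_add_right)

lemma cbracket_skew: "cbracket u v = - cbracket v u"
proof -
  have "- cbracket v u = (\<Sum>i\<in>UNIV. \<Sum>j\<in>UNIV.
        tens (u $ j * v $ i) (bracket (b j) (b i))
        - tens (v $ i * (th i * rat_deriv (u $ j))) (b j)
        + tens (u $ j * (th j * rat_deriv (v $ i))) (b i))"
    unfolding crossed_bracket_def sum_negf[symmetric]
    by (intro sum.cong refl, subst bracket_minus_swap) (simp add: tens_right.minus mult.commute)
  also have "\<dots> = cbracket u v"
    unfolding crossed_bracket_def
    by (subst sum.swap, intro sum.cong refl) (simp add: algebra_simps)
  finally show ?thesis ..
qed

text \<open>Of the three terms of the bracket only the middle one differentiates \<open>v\<close>.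
  It yields the anchor term; elsewhere \<open>f\<close> is a mere factor.\<close>

lemma cbracket_leibniz: "cbracket u (f *s v) = f *s cbracket u v + canchor u f *s v"
proof -
  have "(\<Sum>i\<in>UNIV. \<Sum>j\<in>UNIV. tens (u $ i * (th i * (rat_deriv f * v $ j))) (b j)) =
      (\<Sum>i\<in>UNIV. (u $ i * th i) *s (rat_deriv f *s (\<Sum>j\<in>UNIV. v $ j *s axis j 1)))"
    unfolding sum_cmul[symmetric] tens_basis by (simp add: vs_simps mult.assoc)
  also have "\<dots> = canchor u f *s v"
    unfolding Finite_Cartesian_Product.basis_expansion
    by (simp add: crossed_anchor_def crossed_theta_def vec_eq_iff sum_distrib_right mult.assoc)
  finally have *: "(\<Sum>i\<in>UNIV. \<Sum>j\<in>UNIV. tens (u $ i * (th i * (rat_deriv f * v $ j))) (b j)) =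
      canchor u f *s v" .
  define A where "A i j = tens (u $ i * v $ j) (bracket (b i) (b j))
      + tens (u $ i * (th i * rat_deriv (v $ j))) (b j)
      - tens (v $ j * (th j * rat_deriv (u $ i))) (b i)" for i j
  have "cbracket u (f *s v) = (\<Sum>i\<in>UNIV. \<Sum>j\<in>UNIV.
        f *s A i j + tens (u $ i * (th i * (rat_deriv f * v $ j))) (b j))"
    unfolding crossed_bracket_def A_def
    by (intro sum.cong refl)
      (simp add: rat_deriv_mult tensor_add_left distrib_left vs_simps ac_simps
        flip: tens_scale_left)
  moreover have "cbracket u v = (\<Sum>i\<in>UNIV. \<Sum>j\<in>UNIV. A i j)"
    by (simp add: crossed_bracket_def A_def)
  ultimately show ?thesis
    by (simp add: * sum.distrib sum_cmul)
qed

lemma ctheta_add: "ctheta (u + v) = ctheta u + ctheta v"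
  by (simp add: crossed_theta_def algebra_simps sum.distrib)

lemma ctheta_scale: "ctheta (f *s u) = f * ctheta u"
  by (simp add: crossed_theta_def sum_distrib_left mult.assoc)

sublocale ctheta: Modules.additive ctheta
  by unfold_locales (rule ctheta_add)

lemma ctheta_axis: "ctheta (axis i 1) = th i"
  using ctheta_tens[of 1 "b i"] by (simp add: tens_basis)

text \<open>Once the formula for \<open>\<theta>\<close> of a bracket is inserted, the summands
  factor into a part in \<open>i\<close> and a part in \<open>j\<close>, so that the double sums
  become products of single sums.\<close>

lemma ctheta_cbracket:
  "ctheta (cbracket u v) = ctheta u * rat_deriv (ctheta v) - ctheta v * rat_deriv (ctheta u)"
proof -
  have br: "to_rat (\<theta> (bracket X Y)) =
      to_rat (\<theta> X) * rat_deriv (to_rat (\<theta> Y)) - rat_deriv (to_rat (\<theta> X)) * to_rat (\<theta> Y)" for X Y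
  proof -
    have "\<theta> (bracket X Y) + pderiv (\<theta> X) * \<theta> Y = \<theta> X * pderiv (\<theta> Y)"
      using action by (simp add: poly_action_def)
    then have "to_rat (\<theta> (bracket X Y)) + to_rat (pderiv (\<theta> X)) * to_rat (\<theta> Y)
        = to_rat (\<theta> X) * to_rat (pderiv (\<theta> Y))"
      by (metis to_rat_add to_rat_mult)
    then show ?thesis by (simp add: rat_deriv_to_rat algebra_simps)
  qed
  have "ctheta (cbracket u v) = (\<Sum>i\<in>UNIV. \<Sum>j\<in>UNIV.
        u $ i * th i * (rat_deriv (v $ j) * th j + v $ j * rat_deriv (th j))
        - v $ j * th j * (rat_deriv (u $ i) * th i + u $ i * rat_deriv (th i)))"
    unfolding crossed_bracket_def ctheta.sum
    by (intro sum.cong refl)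
      (simp add: ctheta.add ctheta.diff ctheta_tens br algebra_simps)
  also have "\<dots> = ctheta u * rat_deriv (ctheta v) - ctheta v * rat_deriv (ctheta u)"
  proof -
    have 1: "(\<Sum>i\<in>UNIV. \<Sum>j\<in>UNIV. x i * y j) = (\<Sum>i\<in>UNIV. x i) * (\<Sum>j\<in>UNIV. y j)"
      for x y :: "'n \<Rightarrow> 'k poly fract"
      by (simp add: sum_product)
    have 2: "(\<Sum>i\<in>UNIV. \<Sum>j\<in>UNIV. x j * y i) = (\<Sum>i\<in>UNIV. x i) * (\<Sum>j\<in>UNIV. y j)"
      for x y :: "'n \<Rightarrow> 'k poly fract"
      unfolding 1[symmetric] by (rule sum.swap)
    show ?thesis
      unfolding sum_subtractf crossed_theta_def rat_deriv.sum rat_deriv_mult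
      by (simp only: 1 2)
  qed
  finally show ?thesis .
qed

lemma canchor_cbracket:
  "canchor (cbracket u v) f = canchor u (canchor v f) - canchor v (canchor u f)"
  by (simp add: crossed_anchor_def ctheta_cbracket rat_deriv_mult algebra_simps)

lemma canchor_axis: "canchor (axis j 1) f = th j * rat_deriv f"
  by (simp add: crossed_anchor_def ctheta_axis)

lemma cbracket_tens_1: "cbracket (tens 1 X) (tens 1 Y) = tens 1 (bracket X Y)"
  by (simp add: cbracket_tens rat_deriv_1 tensor_0_left)

lemma bracket_jacobi_tens:
  "tens 1 (bracket X (bracket Y Z)) =
    tens 1 (bracket (bracket X Y) Z) + tens 1 (bracket Y (bracket X Z))"
proof -
  interpret r: Vector_Spaces.linear smul smul "\<lambda>y. bracket w y" for w
    by (fact bracket_linear_right)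
  have "bracket X (bracket Y Z) = - bracket Z (bracket X Y) - bracket Y (bracket Z X)"
    using jacobi[of X Y Z] by (simp add: eq_neg_iff_add_eq_0 algebra_simps)
  then have "bracket X (bracket Y Z) = bracket (bracket X Y) Z + bracket Y (bracket X Z)"
    using bracket_minus_swap[of "bracket X Y" Z] bracket_minus_swap[of Z X] by (simp add: r.neg)
  then show ?thesis by (simp add: tens_add_right)
qed

text \<open>The Jacobiator is alternating, and by the Leibniz rule it is linear in the last argument.\<close>

lemma cbracket_jacobi:
  "cbracket u (cbracket v w) = cbracket (cbracket u v) w + cbracket v (cbracket u w)"
proof -
  define J where
    "J u v w = cbracket u (cbracket v w) - cbracket (cbracket u v) w - cbracket v (cbracket u w)"
    for u v w
  have J12: "J u v w = - J v u w" for u v w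
    using cbracket_skew[of u v] by (simp add: J_def cbracket_left.minus)
  have J23: "J u v w = - J u w v" for u v w
    unfolding J_def cbracket_skew[of v w] cbracket_skew[of "cbracket u v" w]
      cbracket_skew[of v "cbracket u w"] by (simp add: cbracket_right.minus)
  have zero: "J u v w = 0" if "\<And>k. J u v (axis k 1) = 0" for u v w
  proof -
    have scale: "J u v (f *s w) = f *s J u v w" for f w
      by (simp add: J_def cbracket_leibniz cbracket_add_right canchor_cbracket vs_simps)
    interpret Modules.additive "J u v"
      by unfold_locales (simp add: J_def cbracket_add_right)
    have "J u v w = J u v (\<Sum>k\<in>UNIV. w $ k *s axis k 1)"
      by (simp add: Finite_Cartesian_Product.basis_expansion)
    then show ?thesis by (simp add: sum scale that)
  qed
  have tens: "axis i 1 = tens 1 (b i)" for i by (simp add: tens_basis)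
  have "J (axis i 1) (axis j 1) (axis k 1) = 0" for i j k
    using bracket_jacobi_tens[of "b i" "b j" "b k"] by (simp add: J_def tens cbracket_tens_1)
  then have "J (axis i 1) (axis j 1) w = 0" for i j w by (rule zero)
  then have "J (axis i 1) w (axis j 1) = 0" for i j w using J23 by (metis neg_0_equal_iff_equal)
  then have "J (axis i 1) v w = 0" for i v w by (rule zero)
  then have "J u v (axis i 1) = 0" for u v i using J12 J23 by (metis neg_0_equal_iff_equal)
  then have "J u v w = 0" by (rule zero)
  then show ?thesis by (simp add: J_def algebra_simps)
qed

lemma derivation_canchor: "derivation const_rat (canchor u)"
  unfolding derivation_def Vector_Spaces.linear_iff
  using vector_space_over_itself.vector_space_axioms
  by (auto simp: crossed_anchor_def rat_deriv_add rat_deriv_mult rat_deriv_const algebra_simps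
      const_rat_mult const_rat_add const_rat_1 intro!: vector_space.intro)

lemma lie_algebra_cbracket: "lie_algebra (\<lambda>c. (*s) (const_rat c)) cbracket"
proof (intro lie_algebra.intro lie_algebra_axioms.intro)
  have scale: "cbracket u (const_rat c *s v) = const_rat c *s cbracket u v" for u v c
    by (simp add: cbracket_leibniz crossed_anchor_def rat_deriv_const)
  have scale': "cbracket (const_rat c *s u) v = const_rat c *s cbracket u v" for u v c
    by (subst (1 2) cbracket_skew) (simp add: scale vs_simps)
  show "Vector_Spaces.linear (\<lambda>c. (*s) (const_rat c)) (\<lambda>c. (*s) (const_rat c)) (\<lambda>u. cbracket u v)"
    "Vector_Spaces.linear (\<lambda>c. (*s) (const_rat c)) (\<lambda>c. (*s) (const_rat c)) (\<lambda>v. cbracket u v)"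
    for u v
    by (unfold_locales, simp_all add: cbracket_add_left cbracket_add_right scale scale' vs_simps
        const_rat_1 const_rat_add const_rat_mult)
  \<comment> \<open>Skew-symmetry only gives that twice this bracket is 0.\<close>
  show "cbracket u u = 0" for u
    by (rule double_eq_0, rule eq_neg_iff_add_eq_0[THEN iffD1], rule cbracket_skew)
  show "cbracket u (cbracket v w) + cbracket v (cbracket w u) + cbracket w (cbracket u v) = 0"
    for u v w
  proof -
    have "cbracket v (cbracket w u) = - cbracket v (cbracket u w)"
      by (subst cbracket_skew[of w u]) (rule cbracket_right.minus)
    moreover have "cbracket w (cbracket u v) = - cbracket (cbracket u v) w"
      by (rule cbracket_skew)
    ultimately show ?thesis
      unfolding cbracket_jacobi[of u v w] by simp
  qed
qed (rule const_rat_vs.vector_space_axioms)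

sublocale free_lie_rinehart const_rat cbracket canchor
proof (intro free_lie_rinehart.intro lie_rinehart_algebra.intro)
  show "lie_algebra (\<lambda>c. (*s) (const_rat c)) cbracket" by (rule lie_algebra_cbracket)
  show "derivation const_rat (canchor u)" for u by (rule derivation_canchor)
  show "cbracket u (f *s v) = f *s cbracket u v + canchor u f *s v" for u v f
    by (rule cbracket_leibniz)
  show "canchor (cbracket u v) f = canchor u (canchor v f) - canchor v (canchor u f)" for u v f
    by (rule canchor_cbracket)
  show "module ((*s) :: 'k poly fract \<Rightarrow> ('k poly fract, 'n) vec \<Rightarrow> _)"
    by unfold_locales (simp_all add: vs_simps)
qed (simp_all add: algebra_map_const_rat vs_simps crossed_anchor_def ctheta_add ctheta_scale
    algebra_simps)

lemma crossed_schouten_eq: "crossed_schouten smul bracket b \<theta> = br"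
  unfolding crossed_schouten_def by (rule schouten_eq_br)

end

section \<open>Compatible pairs and bialgebras\<close>

lemma ext_power_1E:
  assumes "w \<in> ext_power 1"
  obtains v where "w = ext_vector v"
proof
  have "ext_vector (\<chi> i. w $ {i}) $ I = w $ I" for I
  proof (cases "\<exists>i. I = {i}")
    case True
    then show ?thesis by (auto simp: ext_vector_singleton)
  next
    case False
    then have "card I \<noteq> 1" by (auto simp: card_1_singleton_iff)
    then have "w $ I = 0" using assms by (auto simp: ext_power_def)
    then show ?thesis using False by (auto simp: ext_vector_nth intro!: sum.neutral)
  qed
  then show "w = ext_vector (\<chi> i. w $ {i})" by (simp add: vec_eq_iff)
qed

text \<open>Recovers a coefficient of \<open>w\<close> from its wedge with a basis vector whose
  index does not occur in \<open>I\<close>; used to conclude that a bivector annihilated by all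
  basis vectors vanishes when the rank is not 2.\<close>

lemma wedge_singleton_nth:
  assumes "i \<notin> I"
  shows "(w \<^bold>\<and> monomial {i}) $ insert i I = shuffle_sign I {i} * w $ I"
proof -
  have "(w \<^bold>\<and> monomial {i}) $ insert i I =
      (\<Sum>M\<in>Pow (insert i I). if M = I then shuffle_sign I {i} * w $ I else 0)"
    unfolding wedge_def vec_lambda_beta
  proof (intro sum.cong refl)
    fix M assume "M \<in> Pow (insert i I)"
    then have "insert i I - M = {i} \<longleftrightarrow> M = I" using assms by auto
    then show "shuffle_sign M (insert i I - M) * w $ M * monomial {i} $ (insert i I - M) =
        (if M = I then shuffle_sign I {i} * w $ I else 0)"
      by (cases "M = I") (simp_all add: monomial_nth)
  qed
  then show ?thesis by (simp add: subset_insertI)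
qed

text \<open>The even element \<open>\<Omega> (b i)\<close> moves to the front of the monomial
  without a sign, and the remaining sign is the one in \<open>contract i\<close>. In this form the
  extension is a sum of derivations.\<close>

lemma extend_eq_contract:
  assumes "\<And>i. \<Omega> (b i) \<in> parity_part 0"
  shows "extend b \<Omega> w = (\<Sum>i\<in>UNIV. \<Omega> (b i) \<^bold>\<and> contract i w)"
proof -
  have mon: "(-1) ^ card {j\<in>I. j < i} *s
        (monomial {j\<in>I. j < i} \<^bold>\<and> \<Omega> (b i) \<^bold>\<and> monomial {j\<in>I. i < j})
      = \<Omega> (b i) \<^bold>\<and> contract i (monomial I)" if "i \<in> I" for i I
  proof -
    have split: "{j\<in>I. j < i} \<union> {j\<in>I. i < j} = I - {i}" "{j\<in>I. j < i} \<inter> {j\<in>I. i < j} = {}"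
      by auto
    have "shuffle_sign {j\<in>I. j < i} {j\<in>I. i < j} = (1 :: 'b poly fract)"
      by (intro shuffle_sign_ordered) auto
    then have "monomial {j\<in>I. j < i} \<^bold>\<and> monomial {j\<in>I. i < j} =
        (monomial (I - {i}) :: ('b poly fract, 'a) ext)"
      by (simp add: wedge_monomial split)
    moreover have "monomial {j\<in>I. j < i} \<^bold>\<and> \<Omega> (b i) = \<Omega> (b i) \<^bold>\<and> monomial {j\<in>I. j < i}"
      using wedge_commute[OF assms monomial_parity_part[of _ "card {j\<in>I. j < i}"]] by simp
    moreover have "{j \<in> I - {i}. j < i} = {j\<in>I. j < i}" by auto
    ultimately show ?thesis
      using that by (simp add: contract_monomial shuffle_sign_singleton wedge_linear_simps wedge_assoc)
  qed
  have "(\<Sum>i\<in>I. \<Omega> (b i) \<^bold>\<and> contract i (monomial I)) =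
      (\<Sum>i\<in>UNIV. \<Omega> (b i) \<^bold>\<and> contract i (monomial I))" for I
    by (rule sum.mono_neutral_left) (auto simp: contract_monomial wedge_linear_simps)
  then have "extend b \<Omega> w =
      (\<Sum>I\<in>UNIV. \<Sum>i\<in>UNIV. \<Omega> (b i) \<^bold>\<and> contract i (w $ I *s monomial I))"
    by (simp add: extend_def mon contract_scale wedge_linear_simps sum_cmul)
  also have "\<dots> = (\<Sum>i\<in>UNIV. \<Omega> (b i) \<^bold>\<and> contract i w)"
    by (subst sum.swap) (simp add: ext_expansion flip: contract.sum wedge_right.sum)
  finally show ?thesis .
qed

context crossed_product
begin

abbreviation lvec where "lvec \<equiv> lie_vector smul b"
abbreviation KS where "KS \<equiv> kernel_square b \<theta>"

lemma lvec_basis: "lvec (b i) = monomial {i}"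
  by (simp add: lie_vector_def tens_basis)

lemma lvec_power: "lvec X \<in> ext_power 1"
  unfolding lie_vector_def by (rule ext_vector_power)

lemma br_lvec: "br (lvec X) (lvec Y) = lvec (bracket X Y)"
  by (simp add: lie_vector_def br_vector_vector cbracket_tens_1)

lemma lvec_add: "lvec (X + Y) = lvec X + lvec Y"
  by (simp add: lie_vector_def tens_add_right ext_vector_add)

lemma lvec_scale: "lvec (smul c X) = const_rat c *s lvec X"
  by (simp add: lie_vector_def tens_scale_right tens_scale_left'[of "const_rat c" X]
      ext_vector_scale)

lemma lvec_expansion: "lvec X = (\<Sum>i\<in>UNIV. const_rat (representation (range b) X (b i)) *s monomial {i})"
  by (simp add: lie_vector_def ext_vector_def tensor_def)

section \<open>Contraction with theta, and bivectors over its kernel\<close>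

definition theta_contract :: "('k poly fract, 'n) ext \<Rightarrow> ('k poly fract, 'n) ext" where
  "theta_contract w = (\<Sum>i\<in>UNIV. th i *s contract i w)"

lemma theta_contract_add: "theta_contract (u + v) = theta_contract u + theta_contract v"
  by (simp add: theta_contract_def contract_add vs_simps sum.distrib)

lemma theta_contract_scale: "theta_contract (f *s u) = f *s theta_contract u"
  by (simp add: theta_contract_def contract_scale vs_simps sum_cmul[symmetric] mult.commute)

sublocale theta_contract: Modules.additive theta_contract
  by unfold_locales (rule theta_contract_add)

lemma theta_contract_wedge:
  "theta_contract (ext_vector x \<^bold>\<and> ext_vector y) = ctheta x *s ext_vector y - ctheta y *s ext_vector x"
proof -
  have "contract i (ext_vector x \<^bold>\<and> ext_vector y) = x $ i *s ext_vector y - y $ i *s ext_vector x" for i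
    by (subst wedge_derivation_wedge[OF wedge_derivation_contract ext_vector_parity])
      (simp add: vs_simps)
  then show ?thesis
    by (simp add: theta_contract_def crossed_theta_def vec.scale_sum_left vs_simps sum_subtractf
        mult.commute)
qed

text \<open>The anchor of e_j sends f to theta(b_j) f', so f' factors out and the coefficients
  theta(b_j) assemble to a contraction. Commuting with functions thereby becomes a condition linear
  over K(t).\<close>

lemma br_right_scalar_theta:
  assumes "P \<in> ext_power k"
  shows "br P (ext_scalar f) = - ((-1) ^ k * rat_deriv f) *s theta_contract P"
proof -
  have "P \<in> parity_part k" using assms ext_power_parity by blast
  then show ?thesis
    by (simp add: br_right_scalar canchor_axis grade_involution_parity contract_scale
        theta_contract_def vs_simps sum_cmul[symmetric] sum_negf ac_simps)
qed

lemma ext_power_subspace: "vec.subspace (ext_power k)"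
  by (auto simp: vec.subspace_def ext_power_linear)

lemma kernel_square_power: "KS \<subseteq> ext_power 2"
  unfolding kernel_square_def
proof (rule vec.span_minimal[OF _ ext_power_subspace])
  show "{ext_vector x \<^bold>\<and> ext_vector y |x y. ctheta x = 0 \<and> ctheta y = 0} \<subseteq> ext_power 2"
    using wedge_ext_power[OF ext_vector_power ext_vector_power] by (auto simp: numeral_2_eq_2)
qed

lemma kernel_square_contract:
  assumes "w \<in> KS"
  shows "theta_contract w = 0"
  using assms unfolding kernel_square_def
proof (induction rule: vec.span_induct_alt)
  case (step c x y)
  then show ?case by (auto simp: theta_contract_add theta_contract_scale theta_contract_wedge)
qed (rule theta_contract.zero)

lemma kernel_square_br:
  assumes "w \<in> KS"
  shows "br w (ext_scalar f) = 0"
  using br_right_scalar_theta[of w 2 f] kernel_square_contract[OF assms] kernel_square_power assms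
  by auto

lemma ext_vector_square: "ext_vector x \<^bold>\<and> ext_vector x = (0 :: ('k poly fract, 'n) ext)"
proof (rule double_eq_0)
  show "ext_vector x \<^bold>\<and> ext_vector x + ext_vector x \<^bold>\<and> ext_vector x = (0 :: ('k poly fract, 'n) ext)"
    using wedge_commute[OF ext_vector_parity ext_vector_parity, of x x]
    by (simp add: vs_simps eq_neg_iff_add_eq_0)
qed

text \<open>The projection \<open>x \<mapsto> x - \<theta>(x) x\<^sub>0\<close> onto the kernel of \<open>\<theta>\<close> induces
  \<open>w \<mapsto> w - x\<^sub>0 \<and> \<iota>\<^sub>\<theta> w\<close> on bivectors.\<close>

lemma kernel_squareI:
  assumes x0: "ctheta x0 = 1" and w: "w \<in> ext_power 2" and zero: "theta_contract w = 0"
  shows "w \<in> KS"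
proof -
  define F where "F w = w - ext_vector x0 \<^bold>\<and> theta_contract w" for w :: "('k poly fract, 'n) ext"
  have add: "Modules.additive F"
    by unfold_locales (simp add: F_def theta_contract_add wedge_linear_simps)
  have F_wedge: "F (ext_vector x \<^bold>\<and> ext_vector y) \<in> KS" for x y
  proof -
    let ?p = "\<lambda>x. x - ctheta x *s x0"
    have "ext_vector x \<^bold>\<and> ext_vector x0 = - (ext_vector x0 \<^bold>\<and> ext_vector x :: ('k poly fract, 'n) ext)"
      using wedge_commute[OF ext_vector_parity ext_vector_parity, of x x0] by (simp add: vs_simps)
    then have "F (ext_vector x \<^bold>\<and> ext_vector y) = ext_vector (?p x) \<^bold>\<and> ext_vector (?p y)"
      by (simp add: F_def theta_contract_wedge ext_vector.diff ext_vector_scale wedge_linear_simps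
          vs_simps ext_vector_square)
    moreover have "ctheta (?p x) = 0" for x
      by (simp add: ctheta.diff ctheta_scale x0)
    ultimately show ?thesis
      unfolding kernel_square_def by (intro vec.span_base) blast
  qed
  have "F (w $ I *s monomial I) \<in> KS" for I
  proof (cases "w $ I = 0")
    case True
    then show ?thesis by (simp add: Modules.additive.zero[OF add] kernel_square_def vec.span_zero)
  next
    case False
    then have "card I = 2" using w by (auto simp: ext_power_def)
    \<comment> \<open>With i < j the monomial is e_i \<and> e_j without a sign, and its coefficient
      can be absorbed into the first factor.\<close>
    then obtain i j where "I = {i, j}" "i < j"
      by (auto simp: card_2_iff) (metis insert_commute linorder_neqE)
    then have "w $ I *s monomial I = ext_vector (w $ I *s axis i 1) \<^bold>\<and> ext_vector (axis j 1)"
      using monomial_min[of "{j}" i, where 'a = "'k poly fract"]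
      by (simp add: ext_vector_scale wedge_linear_simps)
    then show ?thesis using F_wedge by metis
  qed
  then have "F w \<in> KS"
    unfolding additive_expansion[OF add, of w] kernel_square_def by (intro vec.span_sum)
  then show ?thesis using zero by (simp add: F_def wedge_linear_simps)
qed

text \<open>Jacobi gives 2 [\<Lambda>, [\<Lambda>, w]] = [[\<Lambda>, \<Lambda>], w], and the mixed
  terms add up to [\<delta>(\<Lambda>), w]. Used in both directions: for the extension of a given
  \<Omega>, and for the remainder of a given bialgebra operator.\<close>

lemma square_expansion:
  assumes \<Lambda>: "\<Lambda> \<in> ext_power 2" and add: "Modules.additive \<delta>"
    and \<delta>: "\<And>y. \<delta> (br \<Lambda> y) = br (\<delta> \<Lambda>) y - br \<Lambda> (\<delta> y)"
  shows "br \<Lambda> (br \<Lambda> w + \<delta> w) + \<delta> (br \<Lambda> w + \<delta> w) =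
    br ((1 / 2) *s br \<Lambda> \<Lambda> + \<delta> \<Lambda>) w + \<delta> (\<delta> w)"
proof -
  have par: "\<Lambda> \<in> parity_part 2" using \<Lambda> ext_power_parity by blast
  have "br \<Lambda> (br \<Lambda> w) + br \<Lambda> (br \<Lambda> w) = br (br \<Lambda> \<Lambda>) w"
    using br_jacobi[OF par par, of w] by (simp add: vs_simps algebra_simps)
  then have "br \<Lambda> (br \<Lambda> w) = br ((1 / 2) *s br \<Lambda> \<Lambda>) w"
    using half_double[of "br \<Lambda> (br \<Lambda> w)"] by (simp add: rat_half br_emb_left)
  then show ?thesis
    by (simp add: br_add_left br_add_right Modules.additive.add[OF add] \<delta>)
qed

section \<open>From compatible pairs to bialgebras\<close>

context
  fixes \<Lambda> :: "('k poly fract, 'n) ext" and \<Omega> :: "'g \<Rightarrow> ('k poly fract, 'n) ext"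
  assumes pair: "(\<Lambda>, \<Omega>) \<in> compatible_pairs smul bracket b \<theta>"
begin

lemma
  shows pair_power: "\<Lambda> \<in> ext_power 2"
    and pair_linear: "Vector_Spaces.linear smul (\<lambda>c w. const_rat c *s w) \<Omega>"
    and pair_kernel: "\<Omega> X \<in> KS"
    and pair_cocycle: "\<Omega> (bracket X Y) = br (\<Omega> X) (lvec Y) + br (lvec X) (\<Omega> Y)"
    and pair_square: "br ((1 / 2) *s br \<Lambda> \<Lambda> + extend b \<Omega> \<Lambda>) (ext_vector x)
      + extend b \<Omega> (extend b \<Omega> (ext_vector x)) = 0"
  using pair by (auto simp: compatible_pairs_def is_cocycle_def crossed_schouten_eq)

lemma extend_pair: "extend b \<Omega> w = (\<Sum>i\<in>UNIV. \<Omega> (b i) \<^bold>\<and> contract i w)"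
proof (rule extend_eq_contract)
  show "\<Omega> (b i) \<in> parity_part 0" for i
    by (rule parity_part_cong[of 2])
      (use pair_kernel kernel_square_power ext_power_parity in auto)
qed

lemma wedge_derivation_extend: "wedge_derivation 1 (extend b \<Omega>)"
proof (rule wedge_derivation_cong)
  have "\<Omega> (b i) \<in> parity_part 2" for i
    using pair_kernel kernel_square_power ext_power_parity by blast
  then show "wedge_derivation (2 + 1) (extend b \<Omega>)"
    unfolding extend_pair
    by (intro wedge_derivation_sum wedge_derivation_left_wedge wedge_derivation_contract)
qed simp

lemma extend_scalar: "extend b \<Omega> (ext_scalar f) = 0"
  by (simp add: extend_pair wedge_linear_simps)

lemma extend_vector: "extend b \<Omega> (monomial {i}) = \<Omega> (b i)"
proof -
  have "extend b \<Omega> (monomial {i}) = (\<Sum>j\<in>UNIV. if j = i then \<Omega> (b j) else 0)"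
    unfolding extend_pair by (rule sum.cong) (simp_all add: wedge_linear_simps)
  then show ?thesis by simp
qed

lemma extend_scale: "extend b \<Omega> (f *s w) = f *s extend b \<Omega> w"
  by (simp add: extend_pair contract_scale wedge_linear_simps sum_cmul)

text \<open>The extension sees only the values on the basis; linearity of \<open>\<Omega>\<close>
  over K supplies the others.\<close>

lemma extend_lvec: "extend b \<Omega> (lvec X) = \<Omega> X"
proof -
  interpret Vector_Spaces.linear smul "\<lambda>c w. const_rat c *s w" \<Omega> by (rule pair_linear)
  have "extend b \<Omega> (lvec X) =
      (\<Sum>i\<in>UNIV. const_rat (representation (range b) X (b i)) *s \<Omega> (b i))"
    unfolding lvec_expansion
    by (simp add: Modules.additive.sum[OF wedge_derivation_additive[OF wedge_derivation_extend]]
        extend_scale extend_vector)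
  also have "\<dots> = \<Omega> (\<Sum>i\<in>UNIV. smul (representation (range b) X (b i)) (b i))"
    by (simp add: sum scale)
  finally show ?thesis
    by (simp add: Defs.basis_expansion[OF lie_algebra_axioms basis action])
qed

lemma extend_power:
  assumes "w \<in> ext_power k"
  shows "extend b \<Omega> w \<in> ext_power (k + 1)"
  unfolding extend_pair
proof (rule ext_power_sum)
  fix i
  show "\<Omega> (b i) \<^bold>\<and> contract i w \<in> ext_power (k + 1)"
    unfolding ext_power_def
  proof (intro CollectI allI impI)
    fix K assume "(\<Omega> (b i) \<^bold>\<and> contract i w) $ K \<noteq> 0"
    then obtain I J where "\<Omega> (b i) $ I \<noteq> 0" "contract i w $ J \<noteq> 0" "I \<inter> J = {}" "K = I \<union> J"
      by (rule wedge_nonzero)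
    moreover have "\<Omega> (b i) \<in> ext_power 2" using pair_kernel kernel_square_power by blast
    ultimately show "card K = k + 1"
      using contract_ext_power[OF assms] by (fastforce simp: card_Un_disjoint ext_power_def)
  qed
qed

text \<open>Each hypothesis on pairs accounts for one test on generators: for a vector and a
  function all terms vanish because elements of L^2 commute with functions, and for two basis
  vectors the claim is the cocycle condition.\<close>

lemma extend_br:
  assumes "x \<in> parity_part p"
  shows "extend b \<Omega> (br x y) = br (extend b \<Omega> x) y + (-1) ^ (p + 1) *s br x (extend b \<Omega> y)"
proof -
  have "extend b \<Omega> (br x y) = br (extend b \<Omega> x) y + (-1) ^ (1 * (p + 1)) *s br x (extend b \<Omega> y)"
  proof (rule bracket_derivation_generators[OF wedge_derivation_extend _ _ _ assms])
    show "br (extend b \<Omega> (ext_scalar f)) (ext_scalar g)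
        + (-1) ^ 1 *s br (ext_scalar f) (extend b \<Omega> (ext_scalar g)) = 0" for f g
      by (simp add: extend_scalar br_zero)
    show "extend b \<Omega> (br (monomial {i}) (ext_scalar f)) =
        br (extend b \<Omega> (monomial {i})) (ext_scalar f)
        + br (monomial {i}) (extend b \<Omega> (ext_scalar f))" for i f
      using br_vector_scalar[of "axis i 1" f]
      by (simp add: extend_scalar extend_vector br_zero kernel_square_br pair_kernel)
    show "extend b \<Omega> (br (monomial {i}) (monomial {j})) =
        br (extend b \<Omega> (monomial {i})) (monomial {j})
        + br (monomial {i}) (extend b \<Omega> (monomial {j}))" for i j
      by (simp add: lvec_basis[symmetric] br_lvec extend_lvec pair_cocycle)
  qed
  then show ?thesis by simp
qed

abbreviation pair_op where "pair_op \<equiv> pair_operator smul bracket b \<theta> \<Lambda> \<Omega>"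

lemma pair_op_eq: "pair_op w = br \<Lambda> w + extend b \<Omega> w"
  by (simp add: pair_operator_def crossed_schouten_eq)

lemma pair_parity: "\<Lambda> \<in> parity_part 2"
  using pair_power ext_power_parity by blast

lemma wedge_derivation_pair: "wedge_derivation 1 pair_op"
proof -
  have "wedge_derivation 1 (br \<Lambda>)"
    by (rule wedge_derivation_cong[OF _ wedge_derivation_br[OF pair_parity]]) simp
  then show ?thesis
    unfolding pair_op_eq[abs_def] by (intro wedge_derivation_add wedge_derivation_extend)
qed

lemma pair_op_square_eq:
  "pair_op (pair_op w) =
    br ((1 / 2) *s br \<Lambda> \<Lambda> + extend b \<Omega> \<Lambda>) w + extend b \<Omega> (extend b \<Omega> w)"
  unfolding pair_op_eq
  by (rule square_expansion[OF pair_power wedge_derivation_additive[OF wedge_derivation_extend]])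
    (simp add: extend_br[OF pair_parity] vs_simps)

text \<open>Compatibility only gives \<open>d\<^sub>*\<^sup>2 = 0\<close> on \<open>E\<close>. For a function \<open>f\<close> it follows that
  \<open>d\<^sub>*\<^sup>2 f \<and> x = 0\<close> for all \<open>x \<in> E\<close>, and then \<open>d\<^sub>*\<^sup>2 f = 0\<close> unless \<open>E\<close> has rank 2; in that case
  \<open>\<and>\<^sup>3 E = 0\<close>.\<close>

lemma pair_op_square: "pair_op (pair_op w) = 0"
proof (rule wedge_derivation_eq_0[of "1 + 1" "\<lambda>w. pair_op (pair_op w)"])
  let ?T = "(1 / 2) *s br \<Lambda> \<Lambda> + extend b \<Omega> \<Lambda>"
  have sq: "wedge_derivation (1 + 1) (\<lambda>w. pair_op (pair_op w))"
    by (intro wedge_derivation_square wedge_derivation_pair) simp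
  then show "wedge_derivation (1 + 1) (\<lambda>w. pair_op (pair_op w))" .
  have vector: "pair_op (pair_op (ext_vector x)) = 0" for x
    unfolding pair_op_square_eq by (rule pair_square)
  show "pair_op (pair_op (monomial {i})) = 0" for i
    using vector[of "axis i 1"] by simp
  fix f
  define W where "W = pair_op (pair_op (ext_scalar f))"
  have W: "W = br ?T (ext_scalar f)"
    by (simp add: W_def pair_op_square_eq extend_scalar
        Modules.additive.zero[OF wedge_derivation_additive[OF wedge_derivation_extend]])
  have "br \<Lambda> \<Lambda> \<in> ext_power 3"
    using br_degree[OF pair_power pair_power] by (fastforce simp: ext_power_def)
  then have T: "?T \<in> ext_power 3"
    using extend_power[OF pair_power] by (intro ext_power_linear) simp_all
  \<comment> \<open>The Leibniz rule for the square on f e_i, where the square vanishes both on f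
    e_i and on e_i.\<close>
  have wedge: "W \<^bold>\<and> monomial {i} = 0" for i
    using wedge_derivation_scale[OF sq, of f "monomial {i}"] vector[of "f *s axis i 1"]
      vector[of "axis i 1"]
    by (simp add: W_def ext_vector_scale)
  have "W $ I = 0" for I
  proof (rule ccontr)
    assume nz: "W $ I \<noteq> 0"
    have I: "card I = 2"
      using br_degree[OF T ext_scalar_power] nz by (fastforce simp: W)
    show False
    proof (cases "I = UNIV")
      case True
      have "?T $ J = 0" for J
      proof -
        have "card J \<le> 2" using I True by (metis card_mono finite subset_UNIV)
        then have "card J \<noteq> 3" by simp
        then show ?thesis using T unfolding ext_power_def by blast
      qed
      then have "?T = 0" by (simp only: vec_eq_iff zero_index simp_thms)
      then show False using nz by (simp only: W br_zero zero_index simp_thms)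
    next
      case False
      then obtain i where "i \<notin> I" by blast
      from wedge_singleton_nth[OF this, of W] have "shuffle_sign I {i} * W $ I = 0"
        by (simp add: wedge)
      then show False using nz shuffle_sign_square[of I "{i}" "W $ I"] by simp
    qed
  qed
  then show "pair_op (pair_op (ext_scalar f)) = 0"
    by (simp add: W_def[symmetric] vec_eq_iff)
qed

lemma pair_op_bialgebra: "pair_op \<in> crossed_bialgebras smul bracket b \<theta>"
  unfolding crossed_bialgebras_def lie_rinehart_bialgebra_def schouten_eq_br
proof (intro CollectI conjI allI ballI)
  show "lie_rinehart_algebra const_rat (*s) cbracket canchor"
    by (rule lie_rinehart_algebra_axioms)
  show "ext_linear const_rat pair_op"
    unfolding ext_linear_iff
    using wedge_derivation_additive[OF wedge_derivation_pair]
    by (simp add: pair_op_eq br_emb_right extend_scale vs_simps)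
  show "pair_op (pair_op x) = 0" for x by (rule pair_op_square)
  fix k and x :: "('k poly fract, 'n) ext" assume x: "x \<in> ext_power k"
  then have par: "x \<in> parity_part k" using ext_power_parity by blast
  have "br \<Lambda> x \<in> ext_power (k + 1)"
    using br_degree[OF pair_power x] by (fastforce simp: ext_power_def)
  then show "pair_op x \<in> ext_power (k + 1)"
    unfolding pair_op_eq by (intro ext_power_linear extend_power x)
  show "pair_op (x \<^bold>\<and> y) = pair_op x \<^bold>\<and> y + (-1) ^ k *s (x \<^bold>\<and> pair_op y)" for y
    using wedge_derivation_wedge[OF wedge_derivation_pair par] by simp
  \<comment> \<open>Bracketing with \<open>\<Lambda>\<close> obeys this rule by Jacobi, whose sign
    exponent 3 (k + 1) has the parity of k + 1.\<close>
  show "pair_op (br x y) = br (pair_op x) y + (-1) ^ (k + 1) *s br x (pair_op y)" for y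
    unfolding pair_op_eq br_jacobi[OF pair_parity par] extend_br[OF par]
    by (cases "even k") (simp_all add: br_add_left br_add_right vs_simps)
qed

end

text \<open>On functions the operators differ by the bracket with \<open>\<nu>\<close>, which
  vanishes since \<open>\<nu>\<close> lies in L^2; on basis vectors the change of
  \<open>\<Lambda>\<close> is compensated by that of \<open>\<Omega>\<close>.\<close>

lemma equivalent_pairs_operator:
  assumes "((\<Lambda>, \<Omega>), (\<Lambda>', \<Omega>')) \<in> equivalent_pairs smul bracket b \<theta>"
  shows "pair_operator smul bracket b \<theta> \<Lambda> \<Omega> = pair_operator smul bracket b \<theta> \<Lambda>' \<Omega>'"
    (is "?\<sigma> = ?\<sigma>'")
proof
  fix w
  obtain \<nu> where pairs: "(\<Lambda>, \<Omega>) \<in> compatible_pairs smul bracket b \<theta>"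
      "(\<Lambda>', \<Omega>') \<in> compatible_pairs smul bracket b \<theta>"
    and \<nu>: "\<nu> \<in> KS" "\<Lambda>' = \<Lambda> + \<nu>" and \<Omega>': "\<And>X. \<Omega>' X = \<Omega> X - br \<nu> (lvec X)"
    using assms by (auto simp: equivalent_pairs_def crossed_schouten_eq)
  note eq = pair_op_eq[OF pairs(1)] pair_op_eq[OF pairs(2)]
  have "?\<sigma> w - ?\<sigma>' w = 0"
  proof (rule wedge_derivation_eq_0[of 1 "\<lambda>w. ?\<sigma> w - ?\<sigma>' w"])
    show "wedge_derivation 1 (\<lambda>w. ?\<sigma> w - ?\<sigma>' w)"
      by (intro wedge_derivation_diff wedge_derivation_pair pairs)
    show "?\<sigma> (ext_scalar f) - ?\<sigma>' (ext_scalar f) = 0" for f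
      unfolding eq extend_scalar[OF pairs(1)] extend_scalar[OF pairs(2)]
      by (simp add: \<nu> br_add_left kernel_square_br)
    show "?\<sigma> (monomial {i}) - ?\<sigma>' (monomial {i}) = 0" for i
      unfolding eq extend_vector[OF pairs(1)] extend_vector[OF pairs(2)]
      by (simp add: \<nu> br_add_left \<Omega>' lvec_basis)
  qed
  then show "?\<sigma> w = ?\<sigma>' w" by simp
qed

end

section \<open>From bialgebras to compatible pairs\<close>

locale nontrivial_crossed_product = crossed_product +
  assumes nontrivial: "\<exists>X. \<theta> X \<noteq> 0"
begin

lemma unit_vector:
  obtains x0 where "ctheta x0 = 1"
proof -
  obtain X where "\<theta> X \<noteq> 0" using nontrivial by blast
  then have "ctheta (tens 1 X) \<noteq> 0"
    by (simp add: ctheta_tens to_rat_def Zero_fract_def eq_fract)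
  then have "ctheta ((1 / ctheta (tens 1 X)) *s tens 1 X) = 1"
    by (simp add: ctheta_scale)
  then show ?thesis by (rule that)
qed

abbreviation tvar :: "'a poly fract" where "tvar \<equiv> to_rat [:0, 1:]"

lemma rat_deriv_tvar: "rat_deriv tvar = 1"
  unfolding rat_deriv_to_rat by (simp add: pderiv_pCons to_rat_def One_fract_def one_pCons)

text \<open>As t has derivative 1, the bracket [w, t] is up to sign the contraction of
  \<open>w\<close> with theta, so this one function decides membership.\<close>

lemma kernel_square_iff:
  assumes "w \<in> ext_power 2"
  shows "w \<in> KS \<longleftrightarrow> br w (ext_scalar tvar) = 0"
proof
  assume "br w (ext_scalar tvar) = 0"
  then have "theta_contract w = 0"
    using br_right_scalar_theta[OF assms, of tvar] by (simp add: rat_deriv_tvar)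
  moreover obtain x0 where "ctheta x0 = 1" by (rule unit_vector)
  ultimately show "w \<in> KS" using assms by (intro kernel_squareI)
qed (rule kernel_square_br)

lemma operator_equivalent_pairs:
  assumes pairs: "(\<Lambda>, \<Omega>) \<in> compatible_pairs smul bracket b \<theta>"
      "(\<Lambda>', \<Omega>') \<in> compatible_pairs smul bracket b \<theta>"
    and eq: "pair_operator smul bracket b \<theta> \<Lambda> \<Omega> = pair_operator smul bracket b \<theta> \<Lambda>' \<Omega>'"
  shows "((\<Lambda>, \<Omega>), (\<Lambda>', \<Omega>')) \<in> equivalent_pairs smul bracket b \<theta>"
proof -
  have eq: "br \<Lambda> w + extend b \<Omega> w = br \<Lambda>' w + extend b \<Omega>' w" for w
    using fun_cong[OF eq, of w] by (simp add: pair_op_eq[OF pairs(1)] pair_op_eq[OF pairs(2)])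
  have "br (\<Lambda>' - \<Lambda>) (ext_scalar tvar) = 0"
    using eq[of "ext_scalar tvar"]
    by (simp add: extend_scalar[OF pairs(1)] extend_scalar[OF pairs(2)] br_diff)
  moreover have "\<Lambda>' - \<Lambda> \<in> ext_power 2"
    by (intro ext_power_linear pair_power[OF pairs(1)] pair_power[OF pairs(2)])
  ultimately have "\<Lambda>' - \<Lambda> \<in> KS" by (simp add: kernel_square_iff)
  moreover have "\<Omega>' X = \<Omega> X - br (\<Lambda>' - \<Lambda>) (lvec X)" for X
    using eq[of "lvec X"]
    by (simp add: extend_lvec[OF pairs(1)] extend_lvec[OF pairs(2)] br_diff algebra_simps)
  ultimately show ?thesis
    using pairs by (auto simp: equivalent_pairs_def crossed_schouten_eq intro!: bexI[of _ "\<Lambda>' - \<Lambda>"])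
qed

context
  fixes \<sigma>
  assumes bialgebra: "\<sigma> \<in> crossed_bialgebras smul bracket b \<theta>"
begin

lemma
  shows bialgebra_additive: "Modules.additive \<sigma>"
    and bialgebra_emb: "\<sigma> (const_rat c *s w) = const_rat c *s \<sigma> w"
    and bialgebra_power: "x \<in> ext_power k \<Longrightarrow> \<sigma> x \<in> ext_power (k + 1)"
    and bialgebra_wedge: "x \<in> ext_power k \<Longrightarrow>
      \<sigma> (x \<^bold>\<and> y) = \<sigma> x \<^bold>\<and> y + (-1) ^ k *s (x \<^bold>\<and> \<sigma> y)"
    and bialgebra_square: "\<sigma> (\<sigma> w) = 0"
    and bialgebra_br: "x \<in> ext_power k \<Longrightarrow>
      \<sigma> (br x y) = br (\<sigma> x) y + (-1) ^ (k + 1) *s br x (\<sigma> y)"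
  using bialgebra
  unfolding crossed_bialgebras_def lie_rinehart_bialgebra_def schouten_eq_br ext_linear_iff
  by blast+

lemma wedge_derivation_bialgebra: "wedge_derivation 1 \<sigma>"
proof (rule wedge_derivationI[OF bialgebra_additive])
  show "\<sigma> x \<in> parity_part (k + 1)" if "x \<in> ext_power k" for x k
    using bialgebra_power[OF that] ext_power_parity by blast
  show "\<sigma> (x \<^bold>\<and> y) = \<sigma> x \<^bold>\<and> y + (-1) ^ (1 * k) *s (x \<^bold>\<and> \<sigma> y)" if "x \<in> ext_power k" for k x y
    using bialgebra_wedge[OF that] by simp
qed

lemma bialgebra_scalar: "\<sigma> (ext_scalar f) = rat_deriv f *s \<sigma> (ext_scalar tvar)"
proof (rule rat_derivation_unique[of "\<lambda>f. \<sigma> (ext_scalar f)"])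
  show "Modules.additive (\<lambda>f. \<sigma> (ext_scalar f))"
    using bialgebra_additive by (simp add: Modules.additive_def ext_scalar_add)
  show "\<sigma> (ext_scalar (f * g)) = g *s \<sigma> (ext_scalar f) + f *s \<sigma> (ext_scalar g)" for f g
    by (simp add: ext_scalar_mult wedge_derivation_scale[OF wedge_derivation_bialgebra])
  \<comment> \<open>The product rule for 1 = 1 * 1 gives twice the same value; linearity over K then
    disposes of all constants.\<close>
  have "\<sigma> (ext_scalar 1) = 0"
    using wedge_derivation_scale[OF wedge_derivation_bialgebra, of 1 "ext_scalar 1"]
    by (simp add: ext_scalar_def)
  then show "\<sigma> (ext_scalar (const_rat c)) = 0" for c
    using bialgebra_emb[of c "ext_scalar 1"] by (simp flip: ext_scalar_mult)
qed

lemma bialgebra_pair: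
  obtains \<Lambda> \<Omega> where "(\<Lambda>, \<Omega>) \<in> compatible_pairs smul bracket b \<theta>"
    "pair_operator smul bracket b \<theta> \<Lambda> \<Omega> = \<sigma>"
proof -
  have "\<sigma> (ext_scalar tvar) \<in> ext_power 1"
    using bialgebra_power[OF ext_scalar_power, of tvar] by simp
  then obtain v where v: "\<sigma> (ext_scalar tvar) = ext_vector v"
    by (rule ext_power_1E)
  \<comment> \<open>The rule for [t, t] = 0 has two summands. They are equal because the minus sign
    of the rule meets the skew-symmetry of the bracket between a vector and a function.\<close>
  have "ext_scalar (ctheta v) + ext_scalar (ctheta v) = (0 :: ('a poly fract, 'c) ext)"
    using bialgebra_br[OF ext_scalar_power, of tvar "ext_scalar tvar"]
    by (simp add: v br_vector_scalar br_scalar_vector vs_simps crossed_anchor_def rat_deriv_tvar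
        Modules.additive.zero[OF bialgebra_additive])
  then have \<theta>v: "ctheta v = 0"
    using double_eq_0 ext_scalar_inj ext_scalar.zero by metis
  obtain x0 where x0: "ctheta x0 = 1" by (rule unit_vector)
  \<comment> \<open>The sign makes the contraction with theta equal to
    \<open>- ext_vector v\<close>, which the minus sign in [\<Lambda>, f] = - f' iota_theta
    \<Lambda> turns into f' v.\<close>
  define \<Lambda> where "\<Lambda> = - (ext_vector x0 \<^bold>\<and> ext_vector v)"
  have \<Lambda>: "\<Lambda> \<in> ext_power 2"
    using wedge_ext_power[OF ext_vector_power ext_vector_power, of x0 v]
    by (simp add: \<Lambda>_def numeral_2_eq_2 ext_power_linear)
  then have par: "\<Lambda> \<in> parity_part 2" using ext_power_parity by blast
  define \<delta> where "\<delta> w = \<sigma> w - br \<Lambda> w" for w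
  have deriv: "wedge_derivation 1 \<delta>"
    unfolding \<delta>_def
    by (intro wedge_derivation_diff wedge_derivation_bialgebra
        wedge_derivation_cong[OF _ wedge_derivation_br[OF par]]) simp
  note add = wedge_derivation_additive[OF deriv]
  have scalar: "\<delta> (ext_scalar f) = 0" for f
  proof -
    have "theta_contract \<Lambda> = - ext_vector v"
      by (simp add: \<Lambda>_def theta_contract.minus theta_contract_wedge x0 \<theta>v)
    then show ?thesis
      by (simp add: \<delta>_def br_right_scalar_theta[OF \<Lambda>] bialgebra_scalar[of f] v vs_simps)
  qed
  have \<delta>_br: "\<delta> (br x y) = br (\<delta> x) y + (-1) ^ (k + 1) *s br x (\<delta> y)" if x: "x \<in> ext_power k" for k x y
  proof -
    have "x \<in> parity_part k" using x ext_power_parity by blast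
    from br_jacobi[OF par this] show ?thesis
      unfolding \<delta>_def bialgebra_br[OF x]
      by (cases "even k") (simp_all add: br_diff vs_simps algebra_simps)
  qed
  define \<Omega> where "\<Omega> X = \<delta> (lvec X)" for X
  have kernel: "\<Omega> X \<in> KS" for X
  proof -
    have "br \<Lambda> (lvec X) \<in> ext_power 2"
      using br_degree[OF \<Lambda> lvec_power] by (fastforce simp: ext_power_def)
    moreover have "\<sigma> (lvec X) \<in> ext_power 2"
      using bialgebra_power[OF lvec_power, of X] by (simp add: numeral_2_eq_2)
    ultimately have "\<Omega> X \<in> ext_power 2"
      unfolding \<Omega>_def \<delta>_def by (intro ext_power_linear)
    \<comment> \<open>Apply \<open>\<delta>\<close> to [X, t]: this bracket is a function, and
      \<open>\<delta>\<close> kills functions, so only [\<Omega>(X), t] is left.\<close>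
    moreover have "br (\<Omega> X) (ext_scalar tvar) = 0"
      using \<delta>_br[OF lvec_power, of X "ext_scalar tvar"]
      by (simp add: \<Omega>_def scalar br_zero lie_vector_def br_vector_scalar)
    ultimately show ?thesis by (simp add: kernel_square_iff)
  qed
  have parity: "\<Omega> X \<in> parity_part 2" for X
    using kernel kernel_square_power ext_power_parity by blast
  have extend: "extend b \<Omega> w = \<delta> w" for w
  proof -
    have even: "\<Omega> X \<in> parity_part 0" for X by (rule parity_part_cong[OF _ parity]) simp
    have "wedge_derivation 1 (\<lambda>w. \<Sum>i\<in>UNIV. \<Omega> (b i) \<^bold>\<and> contract i w)"
      by (intro wedge_derivation_sum wedge_derivation_cong[OF _
            wedge_derivation_left_wedge[OF parity wedge_derivation_contract]]) simp
    \<comment> \<open>Both sides are derivations that kill functions and send e_i to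
      \<open>\<Omega> (b i)\<close>.\<close>
    from wedge_derivation_diff[OF this deriv]
    have "(\<Sum>i\<in>UNIV. \<Omega> (b i) \<^bold>\<and> contract i w) - \<delta> w = 0"
    proof (rule wedge_derivation_eq_0)
      show "(\<Sum>i\<in>UNIV. \<Omega> (b i) \<^bold>\<and> contract i (ext_scalar f)) - \<delta> (ext_scalar f) = 0" for f
        by (simp add: scalar wedge_linear_simps)
      have "(\<Sum>i\<in>UNIV. \<Omega> (b i) \<^bold>\<and> contract i (monomial {j})) =
          (\<Sum>i\<in>UNIV. if i = j then \<Omega> (b j) else 0)" for j
        by (rule sum.cong) (simp_all add: wedge_linear_simps)
      then show "(\<Sum>i\<in>UNIV. \<Omega> (b i) \<^bold>\<and> contract i (monomial {j})) - \<delta> (monomial {j}) = 0" for j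
        by (simp add: \<Omega>_def lvec_basis)
    qed
    then show ?thesis using extend_eq_contract[of \<Omega> b w, OF even] by simp
  qed
  have square: "br ((1 / 2) *s br \<Lambda> \<Lambda> + \<delta> \<Lambda>) w + \<delta> (\<delta> w) = 0" for w
  proof -
    have "br \<Lambda> w + \<delta> w = \<sigma> w" for w by (simp add: \<delta>_def)
    moreover have "\<delta> (br \<Lambda> y) = br (\<delta> \<Lambda>) y - br \<Lambda> (\<delta> y)" for y
      using \<delta>_br[OF \<Lambda>] by (simp add: vs_simps)
    ultimately show ?thesis
      using square_expansion[OF \<Lambda> add, of w] bialgebra_square[of w] by simp
  qed
  have linear: "Vector_Spaces.linear smul (\<lambda>c w. const_rat c *s w) \<Omega>"
    using vector_space_axioms const_rat_vs.vector_space_axioms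
    by (simp add: Vector_Spaces.linear_iff \<Omega>_def lvec_add lvec_scale Modules.additive.add[OF add])
      (simp add: \<delta>_def bialgebra_emb br_emb_right vs_simps)
  have cocycle: "is_cocycle smul bracket b \<theta> \<Omega>"
    using \<delta>_br[OF lvec_power] by (simp add: is_cocycle_def crossed_schouten_eq \<Omega>_def flip: br_lvec)
  show ?thesis
  proof
    show "(\<Lambda>, \<Omega>) \<in> compatible_pairs smul bracket b \<theta>"
      using \<Lambda> linear kernel cocycle square
      by (auto simp: compatible_pairs_def crossed_schouten_eq extend)
    show "pair_operator smul bracket b \<theta> \<Lambda> \<Omega> = \<sigma>"
      by (rule ext) (simp add: pair_operator_def crossed_schouten_eq extend, simp add: \<delta>_def)
  qed
qed

end

end

text \<open>Once equivalence of pairs is known to mean equality of operators, both that it is an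
  equivalence relation and the bijection from classes to operators are formal.\<close>

lemma quotient_by_kernel:
  assumes R: "R = {(p, q). p \<in> C \<and> q \<in> C \<and> F p = F q}"
  shows "equiv C R"
    and "\<exists>\<Phi>. bij_betw \<Phi> (C // R) (F ` C) \<and> (\<forall>p\<in>C. \<Phi> (R `` {p}) = F p)"
proof -
  show equiv: "equiv C R"
    unfolding R by (auto intro!: equivI refl_onI symI transI)
  \<comment> \<open>\<open>F\<close> is constant on a class, so its image there is a singleton and
    no representative has to be chosen.\<close>
  define \<Phi> where "\<Phi> c = the_elem (F ` c)" for c
  have \<Phi>: "\<Phi> (R `` {p}) = F p" if "p \<in> C" for p
  proof -
    have "F ` (R `` {p}) = {F p}" using that by (auto simp: R)
    then show ?thesis by (simp add: \<Phi>_def)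
  qed
  have "bij_betw \<Phi> (C // R) (F ` C)"
    unfolding bij_betw_def
  proof
    show "inj_on \<Phi> (C // R)"
    proof (rule inj_onI)
      fix c d assume "c \<in> C // R" "d \<in> C // R" and eq: "\<Phi> c = \<Phi> d"
      then obtain p q where pq: "p \<in> C" "c = R `` {p}" "q \<in> C" "d = R `` {q}"
        by (auto elim!: quotientE)
      then have "(p, q) \<in> R" using eq by (simp add: \<Phi>) (simp add: R)
      from equiv_class_eq[OF equiv this] show "c = d" by (simp only: pq)
    qed
    show "\<Phi> ` (C // R) = F ` C"
      by (auto simp: \<Phi> quotient_def image_iff)
  qed
  then show "\<exists>\<Phi>. bij_betw \<Phi> (C // R) (F ` C) \<and> (\<forall>p\<in>C. \<Phi> (R `` {p}) = F p)"
    using \<Phi> by blast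
qed

theorem theorem3p3:
  fixes smul :: "'k::real_normed_field \<Rightarrow> 'g::ab_group_add \<Rightarrow> 'g"
    and bracket :: "'g \<Rightarrow> 'g \<Rightarrow> 'g"
    and b :: "'n::{finite,linorder} \<Rightarrow> 'g"
    and \<theta> :: "'g \<Rightarrow> 'k poly"
  assumes "lie_algebra smul bracket"
    and "basis_family smul b"
    and "poly_action smul bracket \<theta>"
    and "\<exists>X. \<theta> X \<noteq> 0"
  shows "equiv (compatible_pairs smul bracket b \<theta>) (equivalent_pairs smul bracket b \<theta>) \<and>
    (\<exists>\<Phi>. bij_betw \<Phi>
            (compatible_pairs smul bracket b \<theta> // equivalent_pairs smul bracket b \<theta>)
            (crossed_bialgebras smul bracket b \<theta>) \<and>
         (\<forall>(\<Lambda>, \<Omega>) \<in> compatible_pairs smul bracket b \<theta>.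
            \<Phi> (equivalent_pairs smul bracket b \<theta> `` {(\<Lambda>, \<Omega>)}) =
              pair_operator smul bracket b \<theta> \<Lambda> \<Omega>))"
proof -
  interpret nontrivial_crossed_product smul bracket b \<theta>
    using assms by (intro nontrivial_crossed_product.intro crossed_product.intro
        crossed_product_axioms.intro nontrivial_crossed_product_axioms.intro)
  let ?C = "compatible_pairs smul bracket b \<theta>" and ?R = "equivalent_pairs smul bracket b \<theta>"
  let ?F = "\<lambda>(\<Lambda>, \<Omega>). pair_operator smul bracket b \<theta> \<Lambda> \<Omega>"
  \<comment> \<open>Reflexivity, symmetry and transitivity of equivalence come from here, with no
    computation with \<open>\<nu>\<close>.\<close>
  have R: "?R = {(p, q). p \<in> ?C \<and> q \<in> ?C \<and> ?F p = ?F q}"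
  proof (intro subset_antisym subrelI)
    fix p q assume "(p, q) \<in> ?R"
    then show "(p, q) \<in> {(p, q). p \<in> ?C \<and> q \<in> ?C \<and> ?F p = ?F q}"
      using equivalent_pairs_operator[of "fst p" "snd p" "fst q" "snd q"]
      by (auto simp: equivalent_pairs_def)
  next
    fix p q assume "(p, q) \<in> {(p, q). p \<in> ?C \<and> q \<in> ?C \<and> ?F p = ?F q}"
    then show "(p, q) \<in> ?R"
      by (cases p; cases q) (auto intro: operator_equivalent_pairs)
  qed
  have "?F ` ?C = crossed_bialgebras smul bracket b \<theta>"
  proof (intro subset_antisym subsetI)
    fix \<sigma> assume "\<sigma> \<in> crossed_bialgebras smul bracket b \<theta>"
    then obtain \<Lambda> \<Omega> where "(\<Lambda>, \<Omega>) \<in> ?C" "pair_operator smul bracket b \<theta> \<Lambda> \<Omega> = \<sigma>"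
      by (rule bialgebra_pair)
    then show "\<sigma> \<in> ?F ` ?C" by force
  qed (auto intro: pair_op_bialgebra)
  then show ?thesis
    using quotient_by_kernel[OF R] by (simp add: split_beta')
qed

end
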